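(* Let $d\ge 2$. For every $p\in(p_c(d),1]$ there is a non-random constant $\mu_d(p)$ such that, $\mathbb{P}_p$-almost surely, for every vertex $x$ of the infinite open cluster $\mathcal C$, $$\limsup_{N\to\infty} \big(Z_N(x)\big)^{1/N}=\mu_d(p)$$ (in particular the left-hand side does not depend on $x\in\mathcal C$ and is non-random). It satisfies $$\mu_d(p)\le p\,\mu_d(1).$$ Moreover, the function $p\mapsto \dfrac{\mu_d(p)}{p\,\mu_d(1)}$ is non-decreasing on $(p_c(d),1]$.
   Context: $\mathbb{Z}^d$ carries its usual nearest-neighbor lattice structure, with edge set $E_d$. Under $\mathbb{P}_p$, $(\omega(e))_{e\in E_d}$ is an IID family of $\{0,1\}$-valued Bernoulli variables with $\mathbb{P}_p(\omega(e)=1)=p$; an edge $e$ is open if $\omega(e)=1$ and closed (deleted) otherwise. $p_c(d)$ is the percolation threshold: for $p\in(p_c(d),1]$ there is $\mathbb{P}_p$-a.s. a unique infinite connected component (cluster) of open edges, denoted $\mathcal C$, and for $p<p_c(d)$ there is none. A self-avoiding path of length $N$ starting at $x$ is a nearest-neighbor path $(S_n)_{0\le n\le N}$ with $S_0=x$ visiting no vertex twice; it is open if all its edges $(S_n,S_{n+1})$ are open. $Z_N(x)$ is the number of open self-avoiding paths of length $N$ starting at $x$. For $p=1$, all edges are open, and $\mu_d(1)=\lim_{N\to\infty}s_N^{1/N}$, where $s_N$ is the number of self-avoiding paths of length $N$ on $\mathbb{Z}^d$ starting at $0$. *)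

theory Defs
  imports "HOL-Probability.Probability"
begin

text \<open>The lattice is \<open>int ^ 'd\<close>, so the dimension is \<open>CARD('d)\<close>.\<close>

definition lattice_adj :: "int ^ 'd \<Rightarrow> int ^ 'd \<Rightarrow> bool" where
  "lattice_adj x y \<longleftrightarrow> (\<Sum>i\<in>UNIV. \<bar>x $ i - y $ i\<bar>) = 1"

definition lattice_edges :: "(int ^ 'd) set set" where
  "lattice_edges = {{x, y} | x y. lattice_adj x y}"

text \<open>A configuration maps each edge to \<open>True\<close> (open, value 1) or \<open>False\<close> (closed, value 0).\<close>

type_synonym 'd config = "(int ^ 'd) set \<Rightarrow> bool"

definition bond_percolation :: "real \<Rightarrow> 'd::finite config measure" where
  "bond_percolation p = (\<Pi>\<^sub>M e\<in>lattice_edges. measure_pmf (bernoulli_pmf p))"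

definition open_adj :: "'d::finite config \<Rightarrow> int ^ 'd \<Rightarrow> int ^ 'd \<Rightarrow> bool" where
  "open_adj \<omega> x y \<longleftrightarrow> lattice_adj x y \<and> \<omega> {x, y}"

definition open_cluster :: "'d::finite config \<Rightarrow> int ^ 'd \<Rightarrow> (int ^ 'd) set" where
  "open_cluster \<omega> x = {y. (open_adj \<omega>)\<^sup>*\<^sup>* x y}"

text \<open>The vertices lying in an infinite open cluster. Above the threshold there is almost surely
  exactly one infinite open cluster, and this set is that cluster.\<close>

definition infinite_open_cluster :: "'d::finite config \<Rightarrow> (int ^ 'd) set" where
  "infinite_open_cluster \<omega> = {x. infinite (open_cluster \<omega> x)}"

definition percolation_threshold :: "'d::finite itself \<Rightarrow> real" where
  "percolation_threshold _ =
     Sup {p \<in> {0..1}. AE \<omega> in (bond_percolation p :: 'd config measure).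
                        infinite_open_cluster \<omega> = {}}"

text \<open>A path \<open>S\<^sub>0, \<dots>, S\<^sub>N\<close> of length \<open>N\<close> is the list of its \<open>N + 1\<close> vertices.\<close>

definition self_avoiding_paths :: "nat \<Rightarrow> int ^ 'd \<Rightarrow> (int ^ 'd) list set" where
  "self_avoiding_paths N x =
     {S. length S = Suc N \<and> S ! 0 = x \<and> distinct S \<and> (\<forall>n<N. lattice_adj (S ! n) (S ! Suc n))}"

definition open_path :: "'d::finite config \<Rightarrow> (int ^ 'd) list \<Rightarrow> bool" where
  "open_path \<omega> S \<longleftrightarrow> (\<forall>n. Suc n < length S \<longrightarrow> \<omega> {S ! n, S ! Suc n})"

definition num_open_paths :: "'d::finite config \<Rightarrow> nat \<Rightarrow> int ^ 'd \<Rightarrow> nat" where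
  "num_open_paths \<omega> N x = card {S \<in> self_avoiding_paths N x. open_path \<omega> S}"

text \<open>This is \<open>\<mu>\<^sub>d(1)\<close>.\<close>

definition connective_constant :: "'d::finite itself \<Rightarrow> real" where
  "connective_constant _ =
     lim (\<lambda>N. root N (real (card (self_avoiding_paths N (0 :: int ^ 'd)))))"

end

(* Idea of the proof.  The law of bond percolation is determined by the probabilities p^|J| that
   all edges of a finite set J are open; translation invariance, insertion tolerance and the
   coupling omega_p = omega_p' and eta_(p/p') are all instances of this.  Translation invariant
   events have probability 0 or 1, by an L^2 argument.

   The infinite cluster is unique by the argument of Burton and Keane.  If three infinite clusters
   coexisted, a positive density of boxes would be trifurcations, that is, their removal would
   leave three infinite branches; but the trifurcation boxes in a large cube inject into its
   boundary.  Exactly two clusters would be merged by opening the edges of a box.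

   The upper growth rate of the number of open paths is the same at neighbouring vertices, hence
   constant on clusters; its supremum over the infinite cluster is translation invariant and
   therefore non-random.  Finally, thinning a fixed configuration with a parameter q multiplies the
   expected number of open paths of length N by q^N, so that by Borel-Cantelli the growth rate
   drops at least by the factor q: mu(q p') <= q mu(p').  With p' = 1 this gives the upper bound. *)

theory Submission
  imports Defs
begin

text \<open>A box is removed by deleting only the edges with both ends in it (\<open>sever\<close>).
  Its vertices survive, so branches are named by vertices of the box itself, and the branching
  condition does not see whether the inner edges are open. It can therefore be checked before these
  edges are opened, and opening them, at the price of a factor p^k for k edges, makes the box
  connected. Trifurcations of positive probability are contradictory because n^d boxes of fixed size
  would contain order n^d of them on average, while the shell around these boxes has only order
  n^(d-1) vertices. The comparison of growth rates cannot start from the expectation under P_p',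
  since E Z_N = p'^N s_N may grow faster than Z_N does in typical configurations. Hence a typical
  configuration is frozen and only the independent thinning is averaged; Fubini allows this. A
  vertex of an infinite cluster after thinning was in an infinite cluster before, so both rates can
  be read off at one vertex.\<close>

section \<open>Disjoint trifurcation sets in a graph\<close>

definition sever :: "'a set set \<Rightarrow> ('a \<Rightarrow> 'a \<Rightarrow> bool) \<Rightarrow> 'a \<Rightarrow> 'a \<Rightarrow> bool" where
  "sever T R x y \<longleftrightarrow> R x y \<and> (\<forall>Q\<in>T. \<not> (x \<in> Q \<and> y \<in> Q))"

lemma sever_empty [simp]: "sever {} R = R"
  by (auto simp: sever_def fun_eq_iff)

lemma sever_sever: "sever S (sever T R) = sever (S \<union> T) R"
  by (auto simp: sever_def fun_eq_iff)

lemma symp_sever: "symp R \<Longrightarrow> symp (sever T R)"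
  by (auto simp: sever_def symp_def)

lemma rtranclp_sever_mono: "(sever T R)\<^sup>*\<^sup>* x y \<Longrightarrow> S \<subseteq> T \<Longrightarrow> (sever S R)\<^sup>*\<^sup>* x y"
  by (erule mono_rtranclp[rule_format, rotated]) (auto simp: sever_def)

lemma rtranclp_commute: "symp R \<Longrightarrow> R\<^sup>*\<^sup>* x y \<Longrightarrow> R\<^sup>*\<^sup>* y x"
  by (meson sympD symp_rtranclp)

text \<open>Up to its first visit to \<open>Q\<close>, a walk uses no edge with both ends in
  \<open>Q\<close>.\<close>

lemma rtranclp_sever_hit:
  assumes "R\<^sup>*\<^sup>* x y"
  shows "(sever {Q} R)\<^sup>*\<^sup>* x y \<or> (\<exists>u\<in>Q. (sever {Q} R)\<^sup>*\<^sup>* x u)"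
  using assms
proof (induction)
  case (step y z)
  then show ?case
    by (cases "y \<in> Q") (auto simp: sever_def intro: rtranclp.rtrancl_into_rtrancl)
qed auto

lemma rtranclp_sever_avoid:
  assumes "R\<^sup>*\<^sup>* x y" and "\<And>u. R\<^sup>*\<^sup>* x u \<Longrightarrow> u \<notin> \<Union>T"
  shows "(sever T R)\<^sup>*\<^sup>* x y"
  using assms(1)
proof (induction)
  case (step y z)
  then have "sever T R y z" using assms(2)[of y] by (auto simp: sever_def)
  with step show ?case by (meson rtranclp.rtrancl_into_rtrancl)
qed auto

lemma rtranclp_within_sever:
  assumes "(\<lambda>x y. R x y \<and> x \<in> Q \<and> y \<in> Q)\<^sup>*\<^sup>* x y" and "\<And>S. S \<in> T \<Longrightarrow> S \<inter> Q = {}"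
  shows "(sever T R)\<^sup>*\<^sup>* x y"
  using assms(1) by (rule mono_rtranclp[rule_format, rotated]) (use assms(2) in \<open>auto simp: sever_def\<close>)

text \<open>Induction on the number of sets. \<open>Q\<close> in \<open>T\<close> and
  \<open>v\<close> in \<open>Q\<close> are chosen so that the branch of \<open>Q\<close> at
  \<open>v\<close> meets as many other members of \<open>T\<close> as possible. By maximality the
  remaining branches of \<open>Q\<close> meet none, and at least two of the three in
  \<open>V\<close>, at \<open>a\<close> and \<open>b\<close>, are of this kind. Of the points of
  \<open>Y\<close> reached from \<open>a\<close> and \<open>b\<close>, at least one is not connected
  to any representative found for \<open>T - {Q}\<close>, so one representative is gained. This is
  the count of leaves of a tree by its branching points.\<close>

lemma trifurcation_representatives:
  fixes R :: "'a \<Rightarrow> 'a \<Rightarrow> bool"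
  assumes "symp R" and "finite T" and "pairwise disjnt T"
    and "\<And>Q x y. Q \<in> T \<Longrightarrow> x \<in> Q \<Longrightarrow> y \<in> Q \<Longrightarrow> (\<lambda>x y. R x y \<and> x \<in> Q \<and> y \<in> Q)\<^sup>*\<^sup>* x y"
    and "\<And>Q. Q \<in> T \<Longrightarrow> \<exists>V \<subseteq> Q. card V = 3 \<and> pairwise (\<lambda>x y. \<not> (sever {Q} R)\<^sup>*\<^sup>* x y) V \<and>
           (\<forall>v\<in>V. \<exists>y\<in>Y. (sever {Q} R)\<^sup>*\<^sup>* v y)"
  shows "\<exists>Y'\<subseteq>Y. finite Y' \<and> card Y' = card T \<and> pairwise (\<lambda>x y. \<not> (sever T R)\<^sup>*\<^sup>* x y) Y'"
  using assms(2-)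
proof (induction "card T" arbitrary: T)
  case 0
  then show ?case by (intro exI[of _ "{}"]) auto
next
  case (Suc n T)
  note symR = \<open>symp R\<close>
  have disj: "P \<inter> Q = {}" if "P \<in> T" "Q \<in> T" "P \<noteq> Q" for P Q
    using Suc.prems(2) that by (auto simp: pairwise_def disjnt_def)
  have conn: "(sever S R)\<^sup>*\<^sup>* x y" if "Q \<in> T" "x \<in> Q" "y \<in> Q" "S \<subseteq> T - {Q}" for Q x y S
    by (rule rtranclp_within_sever[OF Suc.prems(3)[OF that(1-3)]]) (use that disj in blast)
  have comm: "(sever S R)\<^sup>*\<^sup>* y x" if "(sever S R)\<^sup>*\<^sup>* x y" for S x y
    using rtranclp_commute[OF symp_sever[OF symR] that] .
  define Br where "Br Q v = {S \<in> T - {Q}. \<exists>u\<in>S. (sever {Q} R)\<^sup>*\<^sup>* v u}" for Q v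
  have finBr: "finite (Br Q v)" for Q v using Suc.prems(1) by (auto simp: Br_def)
  obtain Q0 where "Q0 \<in> T" using Suc.hyps(2) by fastforce
  moreover from this obtain v0 where "v0 \<in> Q0" using Suc.prems(4)[of Q0] by fastforce
  moreover have "card (Br Q v) < Suc (card T)" for Q v
    using card_mono[OF Suc.prems(1), of "Br Q v"] by (auto simp: Br_def le_imp_less_Suc)
  ultimately have "\<exists>q. (fst q \<in> T \<and> snd q \<in> fst q) \<and>
      (\<forall>r. (fst r \<in> T \<and> snd r \<in> fst r) \<longrightarrow> card (Br (fst r) (snd r)) \<le> card (Br (fst q) (snd q)))"
    by (intro ex_has_greatest_nat[of _ "(Q0, v0)" _ "Suc (card T)"]) (auto simp: less_imp_le)
  then obtain Q v where Q: "Q \<in> T" "v \<in> Q"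
    and max: "\<And>Q' v'. Q' \<in> T \<Longrightarrow> v' \<in> Q' \<Longrightarrow> card (Br Q' v') \<le> card (Br Q v)"
    by fastforce
  \<comment> \<open>By maximality, no other member of \<open>T\<close> lies in a branch different from that of \<open>v\<close>.\<close>
  have empty: "Br Q v' = {}" if v': "v' \<in> Q" "\<not> (sever {Q} R)\<^sup>*\<^sup>* v v'" for v'
  proof (rule ccontr)
    assume "Br Q v' \<noteq> {}"
    then obtain S u0 where S: "S \<in> T" "S \<noteq> Q" "u0 \<in> S" "(sever {Q} R)\<^sup>*\<^sup>* v' u0"
      by (auto simp: Br_def)
    obtain u where u: "u \<in> S" "(sever {S} R)\<^sup>*\<^sup>* v' u"
      using rtranclp_sever_hit[OF S(4), of S] S(3) by (auto simp: sever_sever dest: rtranclp_sever_mono[of _ _ _ _ "{S}"])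
    have uv: "(sever {S} R)\<^sup>*\<^sup>* u v"
      using comm[OF u(2)] conn[OF Q(1) v'(1) Q(2), of "{S}"] S by auto
    have no: False if "(sever {Q} R)\<^sup>*\<^sup>* v s" "s \<in> S" for s
    proof -
      have "(sever {Q} R)\<^sup>*\<^sup>* s u0" using conn[of S s u0 "{Q}"] S Q that by auto
      then have "(sever {Q} R)\<^sup>*\<^sup>* v v'" using that(1) comm[OF S(4)] by auto
      then show False using v' by auto
    qed
    \<comment> \<open>If the branch of \<open>Q\<close> at \<open>v'\<close> met \<open>S\<close>,
      then the branch of \<open>S\<close> at \<open>u\<close> would meet \<open>Q\<close> and, since
      walks from \<open>v\<close> in the graph severed at \<open>Q\<close> never meet
      \<open>S\<close>, also everything counted for \<open>v\<close>: one member more than the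
      maximum.\<close>
    have "insert Q (Br Q v) \<subseteq> Br S u"
    proof
      fix P assume "P \<in> insert Q (Br Q v)"
      then consider "P = Q" | "P \<in> Br Q v" by auto
      then show "P \<in> Br S u"
      proof cases
        case 1 then show ?thesis using uv Q S by (auto simp: Br_def)
      next
        case 2
        then obtain w where w: "P \<in> T" "P \<noteq> Q" "w \<in> P" "(sever {Q} R)\<^sup>*\<^sup>* v w" by (auto simp: Br_def)
        have "(sever {S} (sever {Q} R))\<^sup>*\<^sup>* v w"
          by (rule rtranclp_sever_avoid[OF w(4)]) (use no in auto)
        then have "(sever {S} R)\<^sup>*\<^sup>* v w" by (auto simp: sever_sever dest: rtranclp_sever_mono[of _ _ _ _ "{S}"])
        then have "(sever {S} R)\<^sup>*\<^sup>* u w" using uv by auto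
        moreover have "P \<noteq> S" using no w by auto
        ultimately show ?thesis using w by (auto simp: Br_def)
      qed
    qed
    then have "card (insert Q (Br Q v)) \<le> card (Br S u)" using finBr card_mono by blast
    moreover have "Q \<notin> Br Q v" by (auto simp: Br_def)
    ultimately show False using max[OF S(1) u(1)] finBr[of Q v] by simp
  qed
  obtain V where V: "V \<subseteq> Q" "card V = 3" "pairwise (\<lambda>x y. \<not> (sever {Q} R)\<^sup>*\<^sup>* x y) V"
     "\<And>v. v \<in> V \<Longrightarrow> \<exists>y\<in>Y. (sever {Q} R)\<^sup>*\<^sup>* v y"
    using Suc.prems(4)[OF Q(1)] by blast
  \<comment> \<open>\<open>v\<close> need not lie in \<open>V\<close>, but at most one of three
    pairwise separated vertices can share its branch.\<close>
  have "\<exists>a\<in>V. \<exists>b\<in>V. a \<noteq> b \<and> \<not> (sever {Q} R)\<^sup>*\<^sup>* v a \<and> \<not> (sever {Q} R)\<^sup>*\<^sup>* v b"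
  proof -
    obtain v1 v2 v3 where v: "V = {v1, v2, v3}" "v1 \<noteq> v2" "v1 \<noteq> v3" "v2 \<noteq> v3"
      using V(2) by (auto simp: card_3_iff)
    have "\<not> (sever {Q} R)\<^sup>*\<^sup>* v x \<or> \<not> (sever {Q} R)\<^sup>*\<^sup>* v y" if "x \<in> V" "y \<in> V" "x \<noteq> y" for x y
      using V(3) that comm[of "{Q}" v x] by (metis (mono_tags, lifting) pairwiseD rtranclp_trans)
    from this[of v1 v2] this[of v1 v3] this[of v2 v3] show ?thesis using v by blast
  qed
  then obtain a b where ab: "a \<in> V" "b \<in> V" "a \<noteq> b" "\<not> (sever {Q} R)\<^sup>*\<^sup>* v a" "\<not> (sever {Q} R)\<^sup>*\<^sup>* v b"
    by auto
  have reachY: "\<exists>y\<in>Y. (sever T R)\<^sup>*\<^sup>* c y" if c: "c \<in> V" "\<not> (sever {Q} R)\<^sup>*\<^sup>* v c" for c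
  proof -
    obtain y where y: "y \<in> Y" "(sever {Q} R)\<^sup>*\<^sup>* c y" using V(4)[OF c(1)] by auto
    have "(sever (T - {Q}) (sever {Q} R))\<^sup>*\<^sup>* c y"
      by (rule rtranclp_sever_avoid[OF y(2)]) (use empty[OF _ c(2)] c(1) V(1) in \<open>auto simp: Br_def\<close>)
    moreover have "T - {Q} \<union> {Q} = T" using Q by auto
    ultimately show ?thesis using y by (auto simp: sever_sever)
  qed
  obtain ya where ya: "ya \<in> Y" "(sever T R)\<^sup>*\<^sup>* a ya" using reachY ab by blast
  obtain yb where yb: "yb \<in> Y" "(sever T R)\<^sup>*\<^sup>* b yb" using reachY ab by blast
  have "\<exists>Y'\<subseteq>Y. finite Y' \<and> card Y' = card (T - {Q}) \<and>
      pairwise (\<lambda>x y. \<not> (sever (T - {Q}) R)\<^sup>*\<^sup>* x y) Y'"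
  proof (rule Suc.hyps(1))
    show "n = card (T - {Q})" using Suc.hyps(2) Q Suc.prems(1) by simp
    show "pairwise disjnt (T - {Q})" using Suc.prems(2) by (auto simp: pairwise_def)
  qed (use Suc.prems in auto)
  then obtain Y' where Y': "Y' \<subseteq> Y" "finite Y'" "card Y' = card (T - {Q})"
      and sep: "pairwise (\<lambda>x y. \<not> (sever (T - {Q}) R)\<^sup>*\<^sup>* x y) Y'" by auto
  \<comment> \<open>If \<open>ya\<close> and \<open>yb\<close> were both connected to earlier
    representatives, then either a single representative would join the branches at \<open>a\<close>
    and \<open>b\<close> outside \<open>Q\<close>, or two different ones would be joined through
    \<open>Q\<close>, which is connected once its inner edges are restored.\<close>
  have "\<exists>y\<in>Y. \<forall>y'\<in>Y'. \<not> (sever T R)\<^sup>*\<^sup>* y y'"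
  proof (rule ccontr)
    assume "\<not> ?thesis"
    then obtain y1 y2 where y12: "y1 \<in> Y'" "y2 \<in> Y'" "(sever T R)\<^sup>*\<^sup>* ya y1" "(sever T R)\<^sup>*\<^sup>* yb y2"
      using ya yb by meson
    have a1: "(sever T R)\<^sup>*\<^sup>* a y1" and b2: "(sever T R)\<^sup>*\<^sup>* b y2" using ya yb y12 by auto
    show False
    proof (cases "y1 = y2")
      case True
      then have "(sever T R)\<^sup>*\<^sup>* a b" using a1 comm[OF b2] by auto
      then have "(sever {Q} R)\<^sup>*\<^sup>* a b" using Q by (auto dest: rtranclp_sever_mono[of _ _ _ _ "{Q}"])
      then show False using V(3) ab by (auto simp: pairwise_def)
    next
      case False
      have "(sever (T - {Q}) R)\<^sup>*\<^sup>* a b" using conn[OF Q(1), of a b] ab V(1) by auto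
      moreover have "(sever (T - {Q}) R)\<^sup>*\<^sup>* y1 a"
        by (rule rtranclp_sever_mono[OF comm[OF a1]]) auto
      moreover have "(sever (T - {Q}) R)\<^sup>*\<^sup>* b y2"
        by (rule rtranclp_sever_mono[OF b2]) auto
      ultimately have "(sever (T - {Q}) R)\<^sup>*\<^sup>* y1 y2" by auto
      then show False using sep y12 False by (auto simp: pairwise_def)
    qed
  qed
  then obtain y where y: "y \<in> Y" "\<And>y'. y' \<in> Y' \<Longrightarrow> \<not> (sever T R)\<^sup>*\<^sup>* y y'" by auto
  have "y \<notin> Y'" using y by blast
  then have "card (insert y Y') = card T"
    using Y'(2,3) card.remove[OF Suc.prems(1) Q(1)] by simp
  moreover have "pairwise (\<lambda>x y. \<not> (sever T R)\<^sup>*\<^sup>* x y) Y'"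
    using sep by (rule pairwise_mono) (auto dest: rtranclp_sever_mono[of T _ _ _ "T - {Q}"])
  then have "pairwise (\<lambda>x y. \<not> (sever T R)\<^sup>*\<^sup>* x y) (insert y Y')"
    unfolding pairwise_insert using y(2) comm by blast
  ultimately show ?case using Y'(1,2) y(1) by (intro exI[of _ "insert y Y'"]) simp
qed

section \<open>Self-avoiding paths\<close>

text \<open>An arbitrary relation is allowed so that one set of counting bounds serves both
  \<open>lattice_adj\<close> and \<open>open_adj \<omega>\<close>.\<close>

definition saw :: "('a \<Rightarrow> 'a \<Rightarrow> bool) \<Rightarrow> nat \<Rightarrow> 'a \<Rightarrow> 'a list set" where
  "saw R N x = {S. length S = Suc N \<and> hd S = x \<and> distinct S \<and> successively R S}"

lemma saw_mono: "(\<And>x y. R x y \<Longrightarrow> R' x y) \<Longrightarrow> saw R N x \<subseteq> saw R' N x"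
  by (auto simp: saw_def intro: successively_mono)

lemma saw_0: "saw R 0 x = {[x]}"
  by (auto simp: saw_def length_Suc_conv)

lemma saw_Suc_subset: "saw R (Suc N) x \<subseteq> (\<Union>y\<in>{y. R x y}. (#) x ` saw R N y)"
proof
  fix S assume S: "S \<in> saw R (Suc N) x"
  then obtain y T where "S = x # y # T" by (auto simp: saw_def length_Suc_conv)
  with S show "S \<in> (\<Union>y\<in>{y. R x y}. (#) x ` saw R N y)"
    by (auto simp: saw_def)
qed

lemma finite_saw:
  assumes "\<And>x. finite {y. R x y}"
  shows "finite (saw R N x)"
proof (induction N arbitrary: x)
  case (Suc N)
  have "finite (\<Union>y\<in>{y. R x y}. (#) x ` saw R N y)" using Suc assms by auto
  then show ?case by (rule finite_subset[OF saw_Suc_subset])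
qed (simp add: saw_0)

lemma take_in_saw: "S \<in> saw R N x \<Longrightarrow> k \<le> N \<Longrightarrow> take (Suc k) S \<in> saw R k x"
  unfolding saw_def
  by (auto simp: successively_conv_nth hd_conv_nth)

lemma drop_in_saw: "S \<in> saw R N x \<Longrightarrow> k \<le> N \<Longrightarrow> drop k S \<in> saw R (N - k) (S ! k)"
  unfolding saw_def
  by (auto simp: successively_conv_nth hd_drop_conv_nth)

lemma rev_in_saw:
  assumes "symp R" "S \<in> saw R N x"
  shows "rev S \<in> saw R N (last S)"
  using assms by (auto simp: saw_def hd_rev intro: successively_mono sympD)

lemma saw_take_drop_eq: "take (Suc k) S = take (Suc k) T \<Longrightarrow> drop k S = drop k T \<Longrightarrow> S = T"
  by (metis append_take_drop_id drop_Suc tl_drop)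

text \<open>Cutting at vertex number \<open>M\<close>, which both pieces keep, is injective, and
  both pieces are again self-avoiding. On the lattice this is submultiplicativity.\<close>

lemma card_saw_add_le:
  assumes fin: "\<And>x. finite {y. R x y}" and "\<And>y. card (saw R N y) \<le> K"
  shows "card (saw R (M + N) x) \<le> card (saw R M x) * K"
proof -
  let ?X = "SIGMA A:saw R M x. saw R N (last A)"
  have fX: "finite ?X" using finite_saw[OF fin] by auto
  have "card (saw R (M + N) x) \<le> card ?X"
  proof (rule card_inj_on_le[of "\<lambda>S. (take (Suc M) S, drop M S)"])
    show "inj_on (\<lambda>S. (take (Suc M) S, drop M S)) (saw R (M + N) x)"
      by (rule inj_onI) (auto intro: saw_take_drop_eq)
    show "(\<lambda>S. (take (Suc M) S, drop M S)) ` saw R (M + N) x \<subseteq> ?X"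
    proof clarify
      fix S assume S: "S \<in> saw R (M + N) x"
      then have "last (take (Suc M) S) = S ! M"
        by (auto simp: saw_def take_Suc_conv_app_nth)
      then show "take (Suc M) S \<in> saw R M x \<and> drop M S \<in> saw R N (last (take (Suc M) S))"
        using take_in_saw[OF S, of M] drop_in_saw[OF S, of M] by auto
    qed
  qed (rule fX)
  also have "\<dots> = (\<Sum>A\<in>saw R M x. card (saw R N (last A)))"
    using finite_saw[OF fin] by (simp add: card_SigmaI)
  also have "\<dots> \<le> (\<Sum>A\<in>saw R M x. K)" using assms(2) by (intro sum_mono)
  finally show ?thesis by simp
qed

text \<open>A path from \<open>x\<close> either avoids the neighbour \<open>y\<close>, and can be extended by it, or it is
  cut at \<open>y\<close> into two paths starting at \<open>y\<close>.\<close>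

lemma card_saw_neighbour_le:
  assumes fin: "\<And>x. finite {y. R x y}" and "symp R" "R y x"
  shows "card (saw R N x) \<le> card (saw R (Suc N) y) + (\<Sum>k\<le>N. card (saw R k y) * card (saw R (N - k) y))"
proof -
  note fin = finite_saw[OF fin]
  define A where "A = {S \<in> saw R N x. y \<notin> set S}"
  define B where "B k = {S \<in> saw R N x. S ! k = y}" for k
  have "saw R N x = A \<union> (\<Union>k\<le>N. B k)"
    by (auto simp: A_def B_def saw_def in_set_conv_nth less_Suc_eq_le)
  then have "card (saw R N x) \<le> card A + card (\<Union>k\<le>N. B k)" by (metis card_Un_le)
  also have "card (\<Union>k\<le>N. B k) \<le> (\<Sum>k\<le>N. card (B k))" by (rule card_UN_le) auto
  also have "card A \<le> card (saw R (Suc N) y)"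
  proof (rule card_inj_on_le[of "(#) y"])
    show "(#) y ` A \<subseteq> saw R (Suc N) y"
      using \<open>R y x\<close> by (auto simp: A_def saw_def successively_Cons)
  qed (use fin in auto)
  also have "(\<Sum>k\<le>N. card (B k)) \<le> (\<Sum>k\<le>N. card (saw R k y) * card (saw R (N - k) y))"
  proof (rule sum_mono)
    fix k assume k: "k \<in> {..N}"
    have "card (B k) \<le> card (saw R k y \<times> saw R (N - k) y)"
    proof (rule card_inj_on_le[of "\<lambda>S. (rev (take (Suc k) S), drop k S)"])
      show "inj_on (\<lambda>S. (rev (take (Suc k) S), drop k S)) (B k)"
        by (rule inj_onI) (auto intro: saw_take_drop_eq)
      show "(\<lambda>S. (rev (take (Suc k) S), drop k S)) ` B k \<subseteq> saw R k y \<times> saw R (N - k) y"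
      proof clarify
        fix S assume S: "S \<in> B k"
        then have "last (take (Suc k) S) = y"
          using k by (auto simp: saw_def B_def take_Suc_conv_app_nth)
        then show "rev (take (Suc k) S) \<in> saw R k y \<and> drop k S \<in> saw R (N - k) y"
          using rev_in_saw[OF \<open>symp R\<close> take_in_saw[of S R N x k]] drop_in_saw[of S R N x k] S k
          by (auto simp: B_def)
      qed
    qed (use fin in auto)
    then show "card (B k) \<le> card (saw R k y) * card (saw R (N - k) y)"
      by (simp add: card_cartesian_product)
  qed
  finally show ?thesis by simp
qed

lemma card_saw_bij:
  assumes "bij f" and "\<And>a b. R' (f a) (f b) \<longleftrightarrow> R a b"
  shows "card (saw R' N (f x)) = card (saw R N x)"
proof -
  have "saw R' N (f x) = map f ` saw R N x"
  proof (intro equalityI subsetI)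
    fix S assume S: "S \<in> saw R' N (f x)"
    have inv: "f (inv f y) = y" "inv f (f z) = z" for y z
      using assms(1) by (simp_all add: bij_is_surj surj_f_inv_f bij_is_inj)
    have "S = map f (map (inv f) S)" by (simp add: inv map_idI)
    moreover have "length S = Suc N" "hd S = f x" "distinct S" "successively R' S"
      using S by (auto simp: saw_def)
    then have "map (inv f) S \<in> saw R N x"
      using bij_is_inj[OF bij_imp_bij_inv[OF assms(1)]]
      by (auto simp: saw_def hd_map inv distinct_map successively_map assms(2)[symmetric] intro: inj_on_subset
           simp flip: length_0_conv)
    ultimately show "S \<in> map f ` saw R N x" by (metis image_eqI)
  next
    fix S assume "S \<in> map f ` saw R N x"
    moreover have "inj_on f A" for A using assms(1) by (auto intro: inj_on_subset bij_is_inj)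
    ultimately show "S \<in> saw R' N (f x)"
      using assms by (auto simp: saw_def hd_map distinct_map successively_map simp flip: length_0_conv)
  qed
  moreover have "inj (map f)" using assms(1) by (simp add: bij_is_inj)
  ultimately show ?thesis by (metis card_image inj_on_subset subset_UNIV)
qed

lemma self_avoiding_paths_eq_saw: "self_avoiding_paths N x = saw lattice_adj N x"
  by (auto simp: self_avoiding_paths_def saw_def successively_conv_nth hd_conv_nth
      simp flip: length_greater_0_conv)

lemma num_open_paths_eq: "num_open_paths \<omega> N x = card (saw (open_adj \<omega>) N x)"
  unfolding num_open_paths_def self_avoiding_paths_eq_saw
  by (rule arg_cong[where f = card])
     (auto simp: saw_def successively_conv_nth open_path_def open_adj_def)

section \<open>Self-avoiding paths on the integer lattice\<close>

lemma lattice_adj_commute: "lattice_adj x y \<longleftrightarrow> lattice_adj y x"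
  by (simp add: lattice_adj_def abs_minus_commute)

lemma lattice_adj_translate: "lattice_adj (v + x) (v + y) \<longleftrightarrow> lattice_adj x y"
  by (simp add: lattice_adj_def)

lemma finite_vec_PiE:
  assumes "\<And>i. finite (A i)"
  shows "finite {v :: 'a ^ 'n::finite. \<forall>i. v $ i \<in> A i}"
proof (rule finite_subset)
  show "{v :: 'a ^ 'n. \<forall>i. v $ i \<in> A i} \<subseteq> vec_lambda ` (PiE UNIV A)"
  proof
    fix v assume "v \<in> {v :: 'a ^ 'n. \<forall>i. v $ i \<in> A i}"
    then show "v \<in> vec_lambda ` (PiE UNIV A)"
      by (intro image_eqI[of _ _ "vec_nth v"]) (auto simp: vec_nth_inverse)
  qed
  show "finite (vec_lambda ` (PiE UNIV A))" using assms by (intro finite_imageI finite_PiE) auto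
qed

lemma lattice_adj_coord: "lattice_adj x y \<Longrightarrow> \<bar>x $ i - y $ i\<bar> \<le> 1"
  using member_le_sum[of i UNIV "\<lambda>i. \<bar>x $ i - y $ i\<bar>"] by (simp add: lattice_adj_def)

lemma finite_lattice_adj: "finite {y. lattice_adj x y}"
proof (rule finite_subset)
  show "{y. lattice_adj x y} \<subseteq> {y. \<forall>i. y $ i \<in> {x $ i - 1..x $ i + 1}}"
  proof clarify
    fix y i assume "lattice_adj x y"
    from lattice_adj_coord[OF this, of i] show "y $ i \<in> {x $ i - 1..x $ i + 1}" by (simp add: abs_le_iff)
  qed
qed (rule finite_vec_PiE, simp)

lemma finite_open_adj: "finite {y. open_adj \<omega> x y}"
  by (rule finite_subset[OF _ finite_lattice_adj[of x]]) (auto simp: open_adj_def)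

lemma symp_open_adj: "symp (open_adj \<omega>)"
  by (auto simp: symp_def open_adj_def lattice_adj_commute insert_commute)

lemma lattice_adj_add_axis: "lattice_adj x (x + axis i 1)"
  by (simp add: lattice_adj_def axis_def if_distrib[of abs] cong: if_cong)

lemma card_saw_lattice: "card (saw lattice_adj N (x :: int ^ 'd)) = card (saw lattice_adj N (0 :: int ^ 'd))"
  using card_saw_bij[of "(+) x" lattice_adj lattice_adj N 0] by (simp add: lattice_adj_translate bij_plus)

text \<open>A straight segment along a coordinate axis is self-avoiding. Fekete's lemma below is
  stated for sequences that are at least 1.\<close>

lemma card_saw_lattice_pos: "card (saw lattice_adj N (0 :: int ^ 'd)) \<ge> 1"
proof -
  obtain i :: 'd where True by auto
  define S where "S = map (\<lambda>k. axis i (int k)) [0..<Suc N]"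
  have "S \<in> saw lattice_adj N 0"
  proof -
    have "lattice_adj (axis i (int k) :: int ^ 'd) (axis i (int (Suc k)))" for k
    proof -
      have "axis i (int (Suc k)) = (axis i (int k) :: int ^ 'd) + axis i 1"
        by (simp add: vec_eq_iff axis_def)
      then show ?thesis using lattice_adj_add_axis by metis
    qed
    moreover have "axis i (int 0) = (0 :: int ^ 'd)" by (simp add: vec_eq_iff axis_def)
    ultimately show ?thesis
      by (auto simp: saw_def S_def successively_conv_nth distinct_map inj_on_def axis_eq_axis hd_map nth_append
          simp del: upt_Suc)
  qed
  then have "0 < card (saw lattice_adj N (0 :: int ^ 'd))"
    using finite_saw[of "lattice_adj :: int ^ 'd \<Rightarrow> _", OF finite_lattice_adj, of N 0] unfolding card_gt_0_iff by auto
  then show ?thesis by simp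
qed

lemma card_saw_lattice_submult:
  "card (saw lattice_adj (M + N) (0 :: int ^ 'd)) \<le> card (saw lattice_adj M (0 :: int ^ 'd)) * card (saw lattice_adj N (0 :: int ^ 'd))"
  by (rule card_saw_add_le[OF finite_lattice_adj eq_imp_le[OF card_saw_lattice]])

section \<open>Exponential growth rates and the connective constant\<close>

definition growth :: "(nat \<Rightarrow> nat) \<Rightarrow> ereal" where
  "growth a = limsup (\<lambda>N. ereal (root N (real (a N))))"

text \<open>Together with \<open>growth_less\<close> this exchanges the upper limit of roots for
  bounds of the form C b'^N, as in the Cauchy-Hadamard formula: the constant disappears because its
  N-th root tends to 1. The index 0, where \<open>root\<close> returns 0, is invisible to an upper
  limit.\<close>

lemma growth_le:
  assumes "b \<ge> 0" and "\<And>b'. b' > b \<Longrightarrow> \<exists>C. \<forall>N. real (a N) \<le> C * b' ^ N"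
  shows "growth a \<le> ereal b"
proof (rule dense_ge)
  fix y assume y: "ereal b < y"
  then obtain b' where b': "b' > b" "ereal b' < y"
    using ereal_dense2 by (metis less_ereal.simps(1))
  obtain C where C: "\<And>N. real (a N) \<le> C * b' ^ N" using assms(2)[OF b'(1)] by auto
  have "b' > 0" using assms b' by simp
  \<comment> \<open>\<open>C\<close> may fail to be positive; raising it to at least 1 makes its
    roots converge to 1.\<close>
  define D where "D = max C 1"
  have D: "real (a N) \<le> D * b' ^ N" for N
    using C[of N] \<open>b' > 0\<close> by (auto simp: D_def intro: order_trans[OF _ mult_right_mono])
  have "growth a \<le> limsup (\<lambda>N. ereal (root N D * b'))"
    unfolding growth_def
  proof (rule Limsup_mono, rule eventually_sequentiallyI[of 1])
    fix N :: nat assume "N \<ge> 1"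
    then have "root N (real (a N)) \<le> root N (D * b' ^ N)" using D by simp
    also have "\<dots> = root N D * b'"
      using \<open>N \<ge> 1\<close> \<open>b' > 0\<close> by (simp add: real_root_mult real_root_power_cancel)
    finally show "ereal (root N (real (a N))) \<le> ereal (root N D * b')" by simp
  qed
  also have "(\<lambda>N. root N D * b') \<longlonglongrightarrow> 1 * b'"
    by (intro tendsto_intros LIMSEQ_root_const) (simp add: D_def)
  then have "limsup (\<lambda>N. ereal (root N D * b')) = ereal b'"
    by (intro lim_imp_Limsup) auto
  finally show "growth a \<le> y" using b' by simp
qed

lemma growth_less:
  assumes "growth a < ereal b"
  shows "\<exists>C>0. \<forall>N. real (a N) \<le> C * b ^ N"
proof -
  have "eventually (\<lambda>N. ereal (root N (real (a N))) < ereal b) sequentially"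
    using assms unfolding growth_def by (rule Limsup_lessD)
  then obtain N0 where N0: "\<And>N. N \<ge> N0 \<Longrightarrow> root N (real (a N)) < b"
    by (auto simp: eventually_sequentially)
  have "b > 0" by (rule le_less_trans[OF real_root_ge_zero N0[of "Suc N0"]]) auto
  \<comment> \<open>The sum absorbs the finitely many indices up to \<open>N0\<close>; the summand 1
    serves the others, where b^N itself is a bound.\<close>
  define C where "C = 1 + (\<Sum>k\<le>N0. real (a k) / b ^ k)"
  have nn: "real (a k) / b ^ k \<ge> 0" for k using \<open>b > 0\<close> by simp
  have C1: "C \<ge> 1" unfolding C_def using nn by (simp add: sum_nonneg)
  have "real (a N) \<le> C * b ^ N" for N
  proof (cases "N \<le> N0")
    case True
    then have "real (a N) / b ^ N \<le> (\<Sum>k\<le>N0. real (a k) / b ^ k)"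
      using nn by (intro member_le_sum) auto
    then have "real (a N) / b ^ N \<le> C" by (simp add: C_def)
    then show ?thesis using \<open>b > 0\<close> by (simp add: field_simps)
  next
    case False
    then have "root N (real (a N)) ^ N \<le> b ^ N"
      using N0[of N] by (intro power_mono) auto
    then have "real (a N) \<le> 1 * b ^ N" using False by simp
    also have "\<dots> \<le> C * b ^ N" using C1 \<open>b > 0\<close> by (intro mult_right_mono) auto
    finally show ?thesis .
  qed
  then show ?thesis using C1 by (intro exI[of _ C]) auto
qed

lemma growth_nonneg: "growth a \<ge> 0"
proof -
  have "0 = limsup (\<lambda>N. 0 :: ereal)" by (simp add: Limsup_const)
  also have "\<dots> \<le> growth a" unfolding growth_def by (intro Limsup_mono always_eventually) (simp add: real_root_ge_zero)
  finally show ?thesis .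
qed

lemma growth_mono: "(\<And>N. a N \<le> b N) \<Longrightarrow> growth a \<le> growth b"
  unfolding growth_def
  by (intro Limsup_mono eventually_sequentiallyI[of 1]) (simp add: real_root_le_mono)

text \<open>\<open>connective_constant\<close> is defined by \<open>lim\<close>, which is
  informative only for convergent sequences. The limit is the infimum \<open>L\<close> of the roots:
  no root lies below it, and writing N = q m + r shows that the upper growth rate is at most the
  m-th root, for every m \<ge> 1.\<close>

lemma fekete_submultiplicative:
  fixes s :: "nat \<Rightarrow> nat"
  assumes sub: "\<And>m n. s (m + n) \<le> s m * s n" and pos: "\<And>n. s n \<ge> 1"
  shows "convergent (\<lambda>N. root N (real (s N)))"
proof -
  define L where "L = Inf ((\<lambda>n. root n (real (s n))) ` {1..})"
  have bdd: "bdd_below ((\<lambda>n. root n (real (s n))) ` {1..})"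
    by (rule bdd_belowI[of _ 0]) auto
  have up: "growth s \<le> ereal (root m (real (s m)))" if "m \<ge> 1" for m
  proof (rule growth_le)
    fix b' assume b': "root m (real (s m)) < b'"
    define x where "x = root m (real (s m))"
    \<comment> \<open>This allows the exponent m (N div m) to be rounded up to N.\<close>
    have x1: "x \<ge> 1" unfolding x_def using that pos[of m] by simp
    have xm: "x ^ m = real (s m)" unfolding x_def using that by simp
    define K where "K = (\<Sum>r\<le>m. real (s r))"
    have "real (s N) \<le> K * b' ^ N" for N
    proof -
      have q: "s (q * m + r) \<le> s m ^ q * s r" for q r
      proof (induction q)
        case (Suc q)
        have "s (Suc q * m + r) \<le> s m * s (q * m + r)" using sub[of m "q * m + r"] by (simp add: add.assoc)
        also have "\<dots> \<le> s m * (s m ^ q * s r)" using Suc by (intro mult_left_mono) auto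
        finally show ?case by (simp add: mult.assoc)
      qed simp
      have "real (s N) \<le> real (s m ^ (N div m) * s (N mod m))"
        using q[of "N div m" "N mod m"] by (simp only: of_nat_le_iff) (simp add: div_mult_mod_eq)
      also have "\<dots> = x ^ (m * (N div m)) * real (s (N mod m))"
        by (simp add: power_mult xm)
      also have "\<dots> \<le> x ^ N * K"
      proof (intro mult_mono power_increasing x1)
        show "real (s (N mod m)) \<le> K" unfolding K_def
          using that by (intro member_le_sum) (auto simp: less_imp_le)
      qed (use x1 in auto)
      also have "\<dots> \<le> K * b' ^ N"
      proof -
        have "x ^ N \<le> b' ^ N" using x1 b' by (intro power_mono) (auto simp: x_def)
        moreover have "K \<ge> 0" by (simp add: K_def sum_nonneg)
        ultimately show ?thesis by (simp add: mult.commute mult_left_mono)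
      qed
      finally show ?thesis .
    qed
    then show "\<exists>C. \<forall>N. real (s N) \<le> C * b' ^ N" by auto
  qed (simp add: real_root_ge_zero)
  have "(\<lambda>N. root N (real (s N))) \<longlonglongrightarrow> L"
  proof (rule order_tendstoI)
    fix a assume "a < L"
    have "L \<le> root N (real (s N))" if "N \<ge> 1" for N
      unfolding L_def using bdd that by (intro cInf_lower) auto
    then show "eventually (\<lambda>N. a < root N (real (s N))) sequentially"
      using \<open>a < L\<close> by (intro eventually_sequentiallyI[of 1]) force
  next
    fix a assume "L < a"
    then obtain m where m: "m \<ge> 1" "root m (real (s m)) < a"
      unfolding L_def using bdd by (subst (asm) cInf_less_iff) auto
    then have "growth s < ereal a" using up[of m] by (meson le_less_trans less_ereal.simps(1))
    then show "eventually (\<lambda>N. root N (real (s N)) < a) sequentially"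
      unfolding growth_def by (auto dest: Limsup_lessD)
  qed
  then show ?thesis by (rule convergentI)
qed

lemma growth_lattice: "growth (\<lambda>N. card (saw lattice_adj N (x :: int ^ 'd))) = ereal (connective_constant TYPE('d))"
proof -
  define s where "s N = card (saw lattice_adj N (0 :: int ^ 'd))" for N
  have "convergent (\<lambda>N. root N (real (s N)))"
    unfolding s_def by (intro fekete_submultiplicative card_saw_lattice_submult card_saw_lattice_pos)
  then have "(\<lambda>N. root N (real (s N))) \<longlonglongrightarrow> connective_constant TYPE('d)"
    by (simp add: connective_constant_def self_avoiding_paths_eq_saw s_def convergent_LIMSEQ_iff)
  then have "growth s = ereal (connective_constant TYPE('d))"
    unfolding growth_def by (intro lim_imp_Limsup) auto
  then show ?thesis by (simp add: s_def[abs_def] card_saw_lattice[of _ x])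
qed

lemma connective_constant_nonneg: "connective_constant TYPE('d::finite) \<ge> 0"
  using growth_nonneg[of "\<lambda>N. card (saw lattice_adj N (0 :: int ^ 'd))"] by (simp add: growth_lattice)

text \<open>For \<open>b\<close> above the rate at \<open>y\<close>, each product in
  \<open>card_saw_neighbour_le\<close> is at most C^2 b^N, wherever the path is cut. What remains is
  a factor linear in N, which any b' > b absorbs.\<close>

lemma growth_saw_neighbour_le:
  assumes fin: "\<And>x. finite {y. R x y}" and "symp R" "R y x"
  shows "growth (\<lambda>N. card (saw R N x)) \<le> growth (\<lambda>N. card (saw R N y))"
proof (rule dense_ge)
  fix c assume c: "growth (\<lambda>N. card (saw R N y)) < c"
  then obtain b where b: "growth (\<lambda>N. card (saw R N y)) < ereal b" "ereal b < c"
    using ereal_dense2 by blast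
  have "b > 0" using le_less_trans[OF growth_nonneg b(1)] by simp
  obtain C where C: "C > 0" "\<And>N. real (card (saw R N y)) \<le> C * b ^ N"
    using growth_less[OF b(1)] by auto
  have bound: "real (card (saw R N x)) \<le> (C * b + real (Suc N) * C\<^sup>2) * b ^ N" for N
  proof -
    have "real (card (saw R N x)) \<le> real (card (saw R (Suc N) y)) +
        (\<Sum>k\<le>N. real (card (saw R k y)) * real (card (saw R (N - k) y)))"
      using card_saw_neighbour_le[OF assms, of N] by (simp flip: of_nat_mult of_nat_sum of_nat_add)
    also have "\<dots> \<le> C * b ^ Suc N + (\<Sum>k\<le>N. (C * b ^ k) * (C * b ^ (N - k)))"
      using C(1) C(2)[of "Suc N"] C(2) \<open>b > 0\<close> by (intro add_mono sum_mono mult_mono) auto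
    also have "(\<Sum>k\<le>N. (C * b ^ k) * (C * b ^ (N - k))) = (\<Sum>k\<le>N. C\<^sup>2 * b ^ N)"
      by (intro sum.cong) (auto simp: power2_eq_square simp flip: power_add)
    finally show ?thesis by (simp add: algebra_simps)
  qed
  have "growth (\<lambda>N. card (saw R N x)) \<le> ereal b"
  proof (rule growth_le)
    fix b' assume b': "b < b'"
    have "(\<lambda>N. (C * b + real (Suc N) * C\<^sup>2) * (b / b') ^ N) \<longlonglongrightarrow> 0"
    proof -
      have lim: "(\<lambda>N. (b / b') ^ N) \<longlonglongrightarrow> 0" "(\<lambda>N. real N * (b / b') ^ N) \<longlonglongrightarrow> 0"
        using b' \<open>b > 0\<close> by (auto intro: LIMSEQ_power_zero powser_times_n_limit_0)
      have "(\<lambda>N. (C * b + C\<^sup>2) * (b / b') ^ N + C\<^sup>2 * (real N * (b / b') ^ N)) \<longlonglongrightarrow> (C * b + C\<^sup>2) * 0 + C\<^sup>2 * 0"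
        by (intro tendsto_intros lim)
      then show ?thesis by (simp add: algebra_simps)
    qed
    then have "Bseq (\<lambda>N. (C * b + real (Suc N) * C\<^sup>2) * (b / b') ^ N)"
      by (intro convergent_imp_Bseq convergentI)
    then obtain K where K: "\<And>N. \<bar>(C * b + real (Suc N) * C\<^sup>2) * (b / b') ^ N\<bar> \<le> K"
      by (auto simp: Bseq_def)
    have "real (card (saw R N x)) \<le> K * b' ^ N" for N
    proof -
      have "(C * b + real (Suc N) * C\<^sup>2) * b ^ N = (C * b + real (Suc N) * C\<^sup>2) * (b / b') ^ N * b' ^ N"
        using b' \<open>b > 0\<close> by (simp add: power_divide)
      also have "\<dots> \<le> K * b' ^ N" using K[of N] b' \<open>b > 0\<close> by (intro mult_right_mono) auto
      finally show ?thesis using bound[of N] by linarith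
    qed
    then show "\<exists>C. \<forall>N. real (card (saw R N x)) \<le> C * b' ^ N" by auto
  qed (use \<open>b > 0\<close> in simp)
  then show "growth (\<lambda>N. card (saw R N x)) \<le> c" using b(2) by simp
qed

lemma growth_saw_connected:
  assumes fin: "\<And>x. finite {y. R x y}" and "symp R" "R\<^sup>*\<^sup>* x y"
  shows "growth (\<lambda>N. card (saw R N x)) = growth (\<lambda>N. card (saw R N y))"
  using assms(3)
proof (induction)
  case (step y z)
  then have "R z y" using \<open>symp R\<close> by (auto dest: sympD)
  then show ?case
    using step growth_saw_neighbour_le[OF fin \<open>symp R\<close>, of y z] growth_saw_neighbour_le[OF fin \<open>symp R\<close>, of z y]
    by (simp add: order_antisym)
qed simp

section \<open>The percolation measure\<close>

text \<open>The sigma-algebra does not depend on p, so measurability is proved once here and carried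
  over to every \<open>bond_percolation p\<close>.\<close>

definition config_space :: "'d::finite config measure" where
  "config_space = (\<Pi>\<^sub>M e\<in>lattice_edges. count_space UNIV)"

lemma sets_bond_percolation [measurable_cong]: "sets (bond_percolation p) = sets config_space"
  unfolding bond_percolation_def config_space_def by (intro sets_PiM_cong) auto

lemma space_bond_percolation: "space (bond_percolation p) = space config_space"
  by (rule sets_eq_imp_space_eq[OF sets_bond_percolation])

lemma prob_space_bond_percolation: "prob_space (bond_percolation p)"
  unfolding bond_percolation_def by (rule prob_space_PiM) (rule prob_space_measure_pmf)

lemma space_config_space: "space config_space = extensional lattice_edges"
  by (auto simp: config_space_def space_PiM PiE_def)

definition all_open :: "(int ^ 'd) set set \<Rightarrow> 'd::finite config set" where
  "all_open J = {\<omega> \<in> space config_space. \<forall>e\<in>J. \<omega> e}"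

lemma pred_config_space [measurable]:
  assumes "e \<in> lattice_edges"
  shows "Measurable.pred config_space (\<lambda>\<omega>. \<omega> e)"
  unfolding config_space_def using assms by measurable

lemma measurable_config_spaceI:
  assumes "\<And>e. e \<in> lattice_edges \<Longrightarrow> Measurable.pred M (\<lambda>\<omega>. f \<omega> e)"
  shows "(\<lambda>\<omega>. \<lambda>e\<in>lattice_edges. f \<omega> e) \<in> measurable M config_space"
  unfolding config_space_def using assms by (intro measurable_restrict)

lemma sets_all_open [measurable]:
  assumes "finite J" "J \<subseteq> lattice_edges"
  shows "all_open J \<in> sets config_space"
  using assms
proof (induction J)
  case empty
  show ?case by (simp add: all_open_def)
next
  case (insert e J)
  have "all_open (insert e J) = all_open J \<inter> {\<omega> \<in> space config_space. \<omega> e}" by (auto simp: all_open_def)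
  moreover have "{\<omega> \<in> space config_space. \<omega> e} \<in> sets config_space"
    using insert.prems by (intro predE pred_config_space) auto
  ultimately show ?case using insert by auto
qed

lemma emeasure_all_open:
  assumes "0 \<le> p" "p \<le> 1" "finite J" "J \<subseteq> lattice_edges"
  shows "emeasure (bond_percolation p) (all_open J) = ennreal (p ^ card J)"
proof -
  interpret product_prob_space "\<lambda>_. measure_pmf (bernoulli_pmf p)" "lattice_edges :: (int ^ 'a) set set"
    by unfold_locales
  have "all_open J = {\<omega> \<in> space (\<Pi>\<^sub>M e\<in>lattice_edges. measure_pmf (bernoulli_pmf p)). \<forall>e\<in>J. \<omega> e \<in> {True}}"
    by (simp add: all_open_def space_bond_percolation[of p, unfolded bond_percolation_def])
  then have "emeasure (bond_percolation p) (all_open J) = (\<Prod>e\<in>J. emeasure (measure_pmf (bernoulli_pmf p)) {True})"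
    unfolding bond_percolation_def using emeasure_PiM_Collect[of J "\<lambda>_. {True}"] assms by simp
  also have "\<dots> = ennreal (p ^ card J)"
    using assms by (simp add: emeasure_pmf_single ennreal_power)
  finally show ?thesis .
qed

lemma prob_all_open:
  assumes "0 \<le> p" "p \<le> 1" "finite J" "J \<subseteq> lattice_edges"
  shows "measure (bond_percolation p) (all_open J) = p ^ card J"
  using emeasure_all_open[OF assms] assms(1) by (simp add: measure_def)

lemma all_open_Int: "all_open J \<inter> all_open K = all_open (J \<union> K)"
  by (auto simp: all_open_def)

lemma sets_config_space_generated:
  "sets config_space = sigma_sets (space config_space) {all_open J | J. finite J \<and> J \<subseteq> lattice_edges}"
  (is "_ = sigma_sets ?S ?G")
proof (intro equalityI)
  have "sets config_space = sigma_sets ?S {{f \<in> ?S. f i \<in> A} |i A. i \<in> lattice_edges \<and> A \<in> sets (count_space UNIV)}"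
    using sets_PiM_single[of lattice_edges "\<lambda>_. count_space (UNIV :: bool set)"]
    by (simp add: config_space_def space_PiM)
  also have "\<dots> \<subseteq> sigma_sets ?S ?G"
  proof (rule sigma_sets_mono, clarify)
    fix e :: "(int ^ 'a) set" and A :: "bool set" assume e: "e \<in> lattice_edges"
    have T: "all_open {e} \<in> sigma_sets ?S ?G" using e by (intro sigma_sets.Basic) auto
    have "{f \<in> ?S. f e \<in> A} =
        (if True \<in> A then all_open {e} else {}) \<union> (if False \<in> A then ?S - all_open {e} else {})"
    proof (rule set_eqI)
      show "f \<in> {f \<in> ?S. f e \<in> A} \<longleftrightarrow>
        f \<in> (if True \<in> A then all_open {e} else {}) \<union> (if False \<in> A then ?S - all_open {e} else {})" for f
        by (cases "f e") (auto simp: all_open_def)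
    qed
    then show "{f \<in> ?S. f e \<in> A} \<in> sigma_sets ?S ?G"
      using T by (auto intro!: sigma_sets_Un sigma_sets.Compl sigma_sets.Empty sigma_sets_top)
  qed
  finally show "sets config_space \<subseteq> sigma_sets ?S ?G" .
  show "sigma_sets ?S ?G \<subseteq> sets config_space"
    by (rule sets.sigma_sets_subset) auto
qed

text \<open>Dynkin's uniqueness theorem: the events \<open>all_open J\<close> are closed under
  intersection, and they generate since an edge being closed is a complement. Finite total mass is
  assumed instead of mass 1, because the lemma is also applied to restricted and rescaled
  measures.\<close>

lemma config_measure_eqI:
  assumes "sets M = sets config_space" "sets N = sets config_space"
    and "emeasure M (space M) \<noteq> \<infinity>"
    and "\<And>J. finite J \<Longrightarrow> J \<subseteq> lattice_edges \<Longrightarrow> emeasure M (all_open J) = emeasure N (all_open J)"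
  shows "M = N"
proof (rule measure_eqI_generator_eq)
  let ?G = "{all_open J | J :: (int ^ 'a) set set. finite J \<and> J \<subseteq> lattice_edges}"
  show "Int_stable ?G"
  proof (rule Int_stableI)
    fix A B assume "A \<in> ?G" "B \<in> ?G"
    then obtain J K where "A = all_open J" "B = all_open K" "finite J" "finite K"
        "J \<subseteq> lattice_edges" "K \<subseteq> lattice_edges" by auto
    then show "A \<inter> B \<in> ?G" by (auto simp: all_open_Int intro!: exI[of _ "J \<union> K"])
  qed
  show "?G \<subseteq> Pow (space config_space)" by (auto simp: all_open_def)
  show "sets M = sigma_sets (space config_space) ?G" "sets N = sigma_sets (space config_space) ?G"
    using assms sets_config_space_generated by auto
  show "range (\<lambda>_. all_open {}) \<subseteq> ?G" by auto
  show "(\<Union>i. all_open {}) = space config_space" by (auto simp: all_open_def)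
  show "emeasure M (all_open {}) \<noteq> \<infinity>"
    using assms(3) sets_eq_imp_space_eq[OF assms(1)] by (simp add: all_open_def)
qed (use assms in auto)

subsection \<open>Translations\<close>

text \<open>The state of an edge is read at its shift by \<open>v\<close>, so what surrounds
  \<open>x\<close> afterwards is what surrounded \<open>v + x\<close> before. Restricting to
  \<open>lattice_edges\<close> keeps the result extensional, as points of the product space must be;
  \<open>open_up\<close> and \<open>thin\<close> follow the same pattern.\<close>

definition translate :: "int ^ 'd \<Rightarrow> 'd::finite config \<Rightarrow> 'd config" where
  "translate v \<omega> = (\<lambda>e\<in>lattice_edges. \<omega> ((+) v ` e))"

lemma lattice_edges_translate [simp]: "(+) v ` e \<in> lattice_edges \<longleftrightarrow> e \<in> lattice_edges"
proof -
  have 1: "(+) u ` f \<in> lattice_edges" if "f \<in> lattice_edges" for u and f :: "(int ^ 'a) set"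
    using that lattice_adj_translate[of u] by (fastforce simp: lattice_edges_def)
  have "(+) (- v) ` (+) v ` e = e" by (auto simp: image_image)
  then show ?thesis using 1[of "(+) v ` e" "- v"] 1[of e v] by auto
qed

lemma measurable_translate [measurable]: "translate v \<in> measurable config_space config_space"
  unfolding translate_def[abs_def] by (rule measurable_config_spaceI) simp

lemma vimage_translate_all_open:
  assumes "J \<subseteq> lattice_edges"
  shows "translate v -` all_open J \<inter> space config_space = all_open ((`) ((+) v) ` J)"
  using assms measurable_space[OF measurable_translate[of v]]
  by (auto simp: all_open_def translate_def)

lemma inj_image_translate: "inj ((`) ((+) (v :: int ^ 'd)))"
  by (auto intro!: injI simp: inj_image_eq_iff)

lemma distr_translate:
  assumes "0 \<le> p" "p \<le> 1"
  shows "distr (bond_percolation p) config_space (translate v) = bond_percolation p"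
proof (rule config_measure_eqI)
  interpret prob_space "bond_percolation p" by (rule prob_space_bond_percolation)
  show "emeasure (distr (bond_percolation p) config_space (translate v))
      (space (distr (bond_percolation p) config_space (translate v))) \<noteq> \<infinity>"
    by (simp add: emeasure_distr)
  fix J :: "(int ^ 'a) set set" assume J: "finite J" "J \<subseteq> lattice_edges"
  have "emeasure (distr (bond_percolation p) config_space (translate v)) (all_open J)
      = emeasure (bond_percolation p) (all_open ((`) ((+) v) ` J))"
    using J by (simp add: emeasure_distr space_bond_percolation vimage_translate_all_open)
  also have "\<dots> = emeasure (bond_percolation p) (all_open J)"
    using assms J inj_image_translate[of v]
    by (subst (1 2) emeasure_all_open) (auto simp: card_image inj_on_subset)
  finally show "emeasure (distr (bond_percolation p) config_space (translate v)) (all_open J)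
      = emeasure (bond_percolation p) (all_open J)" .
qed (simp_all add: sets_bond_percolation)

lemma emeasure_vimage_translate:
  assumes "0 \<le> p" "p \<le> 1" "A \<in> sets config_space"
  shows "emeasure (bond_percolation p) (translate v -` A \<inter> space config_space) = emeasure (bond_percolation p) A"
  using assms(3) by (subst (2) distr_translate[OF assms(1,2), of v, symmetric])
    (simp add: emeasure_distr space_bond_percolation)

lemma open_adj_translate: "open_adj (translate v \<omega>) x y \<longleftrightarrow> open_adj \<omega> (v + x) (v + y)"
  by (auto simp: open_adj_def translate_def lattice_adj_translate lattice_edges_def)

subsection \<open>Opening finitely many edges\<close>

definition open_up :: "(int ^ 'd) set set \<Rightarrow> 'd::finite config \<Rightarrow> 'd config" where
  "open_up J \<omega> = (\<lambda>e\<in>lattice_edges. e \<in> J \<or> \<omega> e)"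

lemma measurable_open_up [measurable]: "open_up J \<in> measurable config_space config_space"
  unfolding open_up_def[abs_def] by (rule measurable_config_spaceI) simp

lemma vimage_open_up_all_open:
  assumes "K \<subseteq> lattice_edges"
  shows "open_up J -` all_open K \<inter> space config_space = all_open (K - J)"
  using assms measurable_space[OF measurable_open_up[of J]]
  by (auto simp: all_open_def open_up_def)

text \<open>Insertion tolerance in exact form: given that \<open>J\<close> is open, a configuration
  is distributed like one in which \<open>J\<close> has been opened by force. As measures in
  \<open>A\<close> both sides agree on each \<open>all_open K\<close>, because
  \<open>card (J \<union> K) = card J + card (K - J)\<close>.\<close>

lemma emeasure_Int_all_open:
  assumes p: "0 \<le> p" "p \<le> 1" and J: "finite J" "J \<subseteq> lattice_edges" and A: "A \<in> sets config_space"
  shows "emeasure (bond_percolation p) (all_open J \<inter> A) =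
    ennreal (p ^ card J) * emeasure (bond_percolation p) (open_up J -` A \<inter> space config_space)"
proof -
  interpret prob_space "bond_percolation p" by (rule prob_space_bond_percolation)
  let ?M = "bond_percolation p"
  have dens: "emeasure (density ?M (indicator (all_open J))) B = emeasure ?M (all_open J \<inter> B)"
    if "B \<in> sets config_space" for B
    using that J by (intro emeasure_restricted) (auto simp: sets_bond_percolation)
  have "density ?M (indicator (all_open J)) = scale_measure (p ^ card J) (distr ?M config_space (open_up J))"
  proof (rule config_measure_eqI)
    show "emeasure (density ?M (indicator (all_open J))) (space (density ?M (indicator (all_open J)))) \<noteq> \<infinity>"
      using dens[of "space config_space"] by (simp add: space_bond_percolation)
    fix K :: "(int ^ 'a) set set" assume K: "finite K" "K \<subseteq> lattice_edges"
    have "emeasure (density ?M (indicator (all_open J))) (all_open K) = ennreal (p ^ card (J \<union> K))"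
      using J K p by (subst dens) (auto simp: all_open_Int emeasure_all_open)
    also have "card (J \<union> K) = card J + card (K - J)"
      using J K by (metis card_Un_disjoint Diff_disjoint finite_Diff Un_Diff_cancel)
    also have "ennreal (p ^ (card J + card (K - J))) = ennreal (p ^ card J) * ennreal (p ^ card (K - J))"
      using p by (simp add: power_add ennreal_mult)
    also have "\<dots> = emeasure (scale_measure (p ^ card J) (distr ?M config_space (open_up J))) (all_open K)"
      using J K p by (subst emeasure_all_open[symmetric])
        (auto simp: emeasure_distr vimage_open_up_all_open space_bond_percolation)
    finally show "emeasure (density ?M (indicator (all_open J))) (all_open K) =
        emeasure (scale_measure (p ^ card J) (distr ?M config_space (open_up J))) (all_open K)" .
  qed (simp_all add: sets_bond_percolation)
  then show ?thesis
    using dens[OF A] A by (simp add: emeasure_distr space_bond_percolation)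
qed

subsection \<open>Thinning\<close>

definition thin :: "'d::finite config \<Rightarrow> 'd config \<Rightarrow> 'd config" where
  "thin \<eta> \<omega> = (\<lambda>e\<in>lattice_edges. \<eta> e \<and> \<omega> e)"

lemma measurable_thin [measurable]:
  "(\<lambda>x. thin (fst x) (snd x)) \<in> measurable (config_space \<Otimes>\<^sub>M config_space) config_space"
  unfolding thin_def by (rule measurable_config_spaceI) measurable

text \<open>An edge survives if it is open in two independent configurations, so a finite set of k
  edges survives with probability q^k p^k.\<close>

lemma distr_thin:
  assumes "0 \<le> p" "p \<le> 1" "0 \<le> q" "q \<le> 1"
  shows "distr (bond_percolation q \<Otimes>\<^sub>M bond_percolation p) config_space (\<lambda>x. thin (fst x) (snd x))
    = (bond_percolation (q * p) :: 'd::finite config measure)" (is "?D = _")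
proof (rule config_measure_eqI)
  let ?P = "bond_percolation p :: 'd config measure" and ?Q = "bond_percolation q :: 'd config measure"
  interpret MP: prob_space ?P by (rule prob_space_bond_percolation)
  interpret MQ: prob_space ?Q by (rule prob_space_bond_percolation)
  interpret pair: pair_prob_space ?Q ?P ..
  have meas: "(\<lambda>x. thin (fst x) (snd x)) \<in> measurable (?Q \<Otimes>\<^sub>M ?P) config_space"
    using measurable_thin
    by (simp add: measurable_cong_sets[OF sets_pair_measure_cong[OF sets_bond_percolation sets_bond_percolation] refl])
  interpret D: prob_space ?D by (rule pair.P.prob_space_distr[OF meas])
  show "emeasure ?D (space ?D) \<noteq> \<infinity>" by simp
  fix J :: "(int ^ 'd) set set" assume J: "finite J" "J \<subseteq> lattice_edges"
  have "(\<lambda>x. thin (fst x) (snd x)) -` all_open J \<inter> space (?Q \<Otimes>\<^sub>M ?P) = all_open J \<times> all_open J"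
    using J by (auto simp: all_open_def thin_def space_pair_measure space_bond_percolation space_config_space)
  then have "emeasure ?D (all_open J) = emeasure ?Q (all_open J) * emeasure ?P (all_open J)"
    using J by (simp add: emeasure_distr[OF meas] MP.emeasure_pair_measure_Times sets_bond_percolation)
  also have "\<dots> = emeasure (bond_percolation (q * p)) (all_open J)"
    using J assms by (simp add: emeasure_all_open mult_le_one power_mult_distrib ennreal_mult)
  finally show "emeasure ?D (all_open J) = emeasure (bond_percolation (q * p)) (all_open J)" .
qed (simp_all add: sets_bond_percolation)

subsection \<open>Ergodicity\<close>

lemma disjoint_translates:
  fixes J :: "(int ^ 'd::finite) set set"
  assumes "finite J" "J \<subseteq> lattice_edges"
  shows "\<exists>v :: nat \<Rightarrow> int ^ 'd. \<forall>i j. i \<noteq> j \<longrightarrow> (`) ((+) (v i)) ` J \<inter> (`) ((+) (v j)) ` J = {}"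
proof -
  obtain k :: 'd where True by auto
  have fin: "finite (\<Union>J)"
  proof (intro finite_Union assms(1))
    fix e assume "e \<in> J"
    then show "finite e" using assms(2) by (auto simp: lattice_edges_def)
  qed
  \<comment> \<open>All endpoints of edges in \<open>J\<close> have k-th coordinate of absolute
    value below \<open>K\<close>, so shifts along axis \<open>k\<close> by different multiples of 2
    K cannot overlap. A sum, unlike a maximum, also covers empty \<open>J\<close>.\<close>
  define K where "K = 1 + (\<Sum>x\<in>\<Union>J. \<bar>x $ k\<bar>)"
  have K: "\<bar>x $ k\<bar> < K" if "x \<in> \<Union>J" for x
    using member_le_sum[OF that, of "\<lambda>x. \<bar>x $ k\<bar>"] fin by (simp add: K_def)
  have K1: "K \<ge> 1" by (simp add: K_def sum_nonneg)
  define v :: "nat \<Rightarrow> int ^ 'd" where "v i = axis k (2 * K * int i)" for i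
  have "(`) ((+) (v i)) ` J \<inter> (`) ((+) (v j)) ` J = {}" if "i \<noteq> j" for i j
  proof (rule ccontr)
    assume "\<not> ?thesis"
    then obtain e f where ef: "e \<in> J" "f \<in> J" "(+) (v i) ` e = (+) (v j) ` f" by auto
    have "e \<noteq> {}" using ef(1) assms(2) by (auto simp: lattice_edges_def)
    then obtain x where x: "x \<in> e" by auto
    then obtain y where y: "y \<in> f" "v i + x = v j + y" using ef(3) by (metis imageE image_eqI)
    then have "(v i + x) $ k = (v j + y) $ k" by simp
    then have eq: "2 * K * (int i - int j) = y $ k - x $ k" by (simp add: v_def axis_def algebra_simps)
    have "\<bar>y $ k - x $ k\<bar> < 2 * K" using K[of x] K[of y] ef x y by fastforce
    moreover have "2 * K * 1 \<le> \<bar>2 * K * (int i - int j)\<bar>"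
      unfolding abs_mult using K1 that by (intro mult_mono) auto
    ultimately show False using eq by simp
  qed
  then show ?thesis by blast
qed

text \<open>An invariant event has the same correlation with the infinitely many disjoint translates
  of a cylinder event, whose averages converge to a constant in \<open>L\<^sup>2\<close>.\<close>

lemma invariant_Int_all_open:
  fixes J :: "(int ^ 'd::finite) set set"
  assumes p: "0 \<le> p" "p \<le> 1" and J: "finite J" "J \<subseteq> lattice_edges" and A: "A \<in> sets config_space"
    and inv: "\<And>v. translate v -` A \<inter> space config_space = A"
  shows "measure (bond_percolation p) (A \<inter> all_open J) =
    measure (bond_percolation p) A * measure (bond_percolation p) (all_open J)"
proof -
  let ?M = "bond_percolation p"
  interpret prob_space ?M by (rule prob_space_bond_percolation)
  have AM [measurable]: "A \<in> sets ?M" using A by (simp add: sets_bond_percolation)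
  obtain v :: "nat \<Rightarrow> int ^ 'd" where v: "\<And>i j. i \<noteq> j \<Longrightarrow> (`) ((+) (v i)) ` J \<inter> (`) ((+) (v j)) ` J = {}"
    using disjoint_translates[OF J] by metis
  define K where "K i = (`) ((+) (v i)) ` J" for i
  define C where "C i = all_open (K i)" for i
  define c where "c = p ^ card J"
  have K: "finite (K i)" "K i \<subseteq> lattice_edges" "card (K i) = card J" for i
    using J inj_image_translate[of "v i"] by (auto simp: K_def card_image inj_on_subset)
  have C [measurable]: "C i \<in> sets ?M" for i using K by (simp add: C_def sets_bond_percolation)
  have PC: "prob (C i) = c" for i using K p by (simp add: C_def prob_all_open c_def)
  have PCC: "prob (C i \<inter> C j) = c * c" if "i \<noteq> j" for i j
    using K p v[OF that] by (simp add: C_def all_open_Int prob_all_open c_def card_Un_disjoint power_add flip: K_def)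
  have PA: "prob (A \<inter> C i) = prob (A \<inter> all_open J)" for i
  proof -
    have "translate (v i) -` (A \<inter> all_open J) \<inter> space config_space = A \<inter> C i"
      using inv[of "v i"] vimage_translate_all_open[OF J(2), of "v i"] by (auto simp: C_def K_def)
    then show ?thesis
      using emeasure_vimage_translate[OF p, of "A \<inter> all_open J" "v i"] A J by (simp add: measure_def)
  qed
  have c01: "0 \<le> c" "c \<le> 1" using p by (auto simp: c_def power_le_one)
  define X where "X n \<omega> = (\<Sum>i<n. indicat_real (C i) \<omega> - c)" for n \<omega>
  have [measurable]: "X n \<in> borel_measurable ?M" for n unfolding X_def by measurable
  have bX: "\<bar>X n \<omega>\<bar> \<le> real n" for n \<omega>
  proof -
    have "\<bar>X n \<omega>\<bar> \<le> (\<Sum>i<n. 1)"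
      unfolding X_def using c01 by (intro order_trans[OF sum_abs] sum_mono) (auto simp: indicator_def)
    then show ?thesis by simp
  qed
  have intX: "integrable ?M (X n)" "integrable ?M (\<lambda>\<omega>. (X n \<omega>)\<^sup>2)" "integrable ?M (\<lambda>\<omega>. indicator A \<omega> * X n \<omega>)" for n
  proof -
    show "integrable ?M (X n)" by (rule integrable_const_bound[of _ "real n"]) (auto simp: bX)
    show "integrable ?M (\<lambda>\<omega>. (X n \<omega>)\<^sup>2)"
      by (rule integrable_const_bound[of _ "(real n)\<^sup>2"]) (auto simp: bX abs_le_square_iff[symmetric])
    show "integrable ?M (\<lambda>\<omega>. indicator A \<omega> * X n \<omega>)"
      by (rule integrable_const_bound[of _ "real n"]) (auto simp: bX indicator_def)
  qed
  \<comment> \<open>Events on disjoint translates are pairwise independent, so the mixed terms of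
    the square have mean 0 and only the n diagonal terms c - c^2 remain.\<close>
  have var: "expectation (\<lambda>\<omega>. (X n \<omega>)\<^sup>2) \<le> real n" for n
  proof -
    have "(X n \<omega>)\<^sup>2 = (\<Sum>i<n. \<Sum>j<n. indicat_real (C i \<inter> C j) \<omega> - c * indicat_real (C i) \<omega> - c * indicat_real (C j) \<omega> + c * c)" for \<omega>
      unfolding X_def power2_eq_square sum_product
      by (intro sum.cong refl) (auto simp: indicator_inter_arith algebra_simps)
    then have "expectation (\<lambda>\<omega>. (X n \<omega>)\<^sup>2) = (\<Sum>i<n. \<Sum>j<n. prob (C i \<inter> C j) - c * c)"
      by (simp add: PC prob_space emeasure_eq_measure)
    also have "\<dots> = (\<Sum>i<n. \<Sum>j<n. if i = j then c - c * c else 0)"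
      by (intro sum.cong refl) (auto simp: PC PCC)
    also have "\<dots> = real n * (c - c * c)" by simp
    also have "\<dots> \<le> real n * 1" using c01 mult_nonneg_nonneg[OF c01(1) c01(1)] by (intro mult_left_mono) linarith+
    finally show ?thesis by simp
  qed
  define \<delta> where "\<delta> = prob (A \<inter> all_open J) - c * prob A"
  have EA: "expectation (\<lambda>\<omega>. indicator A \<omega> * X n \<omega>) = real n * \<delta>" for n
  proof -
    have "indicator A \<omega> * X n \<omega> = (\<Sum>i<n. indicat_real (A \<inter> C i) \<omega> - c * indicat_real A \<omega>)" for \<omega>
      unfolding X_def sum_distrib_left
      by (intro sum.cong refl) (auto simp: indicator_inter_arith algebra_simps)
    then show ?thesis by (simp add: PA \<delta>_def emeasure_eq_measure)
  qed
  have small: "\<bar>\<delta>\<bar> \<le> 1 / real m" if "m \<ge> 1" for m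
  proof -
    \<comment> \<open>With n = m^2 the two halves of the bound \<open>amgm\<close> balance in the
      mean: n |\<delta>| \<le> (n/m + m)/2 = m, that is |\<delta>| \<le> 1/m.\<close>
    define n where "n = m\<^sup>2"
    have amgm: "\<bar>indicat_real A \<omega> * X n \<omega>\<bar> \<le> ((X n \<omega>)\<^sup>2 / real m + real m) / 2" for \<omega>
    proof -
      have "\<bar>indicat_real A \<omega> * X n \<omega>\<bar> \<le> \<bar>X n \<omega>\<bar>" by (auto simp: indicator_def)
      moreover have "0 \<le> (\<bar>X n \<omega>\<bar> - real m)\<^sup>2" by simp
      then have "2 * \<bar>X n \<omega>\<bar> * real m \<le> (X n \<omega>)\<^sup>2 + (real m)\<^sup>2" by (simp add: power2_diff)
      then have "\<bar>X n \<omega>\<bar> \<le> ((X n \<omega>)\<^sup>2 / real m + real m) / 2"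
        using that by (simp add: field_simps power2_eq_square)
      ultimately show ?thesis by linarith
    qed
    have "\<bar>real n * \<delta>\<bar> \<le> expectation (\<lambda>\<omega>. \<bar>indicat_real A \<omega> * X n \<omega>\<bar>)"
      unfolding EA[symmetric] by (rule integral_abs_bound)
    also have "\<dots> \<le> expectation (\<lambda>\<omega>. ((X n \<omega>)\<^sup>2 / real m + real m) / 2)"
      using intX by (intro integral_mono amgm) auto
    also have "\<dots> = (expectation (\<lambda>\<omega>. (X n \<omega>)\<^sup>2) / real m + real m) / 2"
      using intX by (simp add: prob_space)
    also have "\<dots> \<le> (real n / real m + real m) / 2"
      using var[of n] that by (simp add: divide_right_mono)
    also have "\<dots> = real m" using that by (simp add: n_def power2_eq_square)
    finally have "real m * (real m * \<bar>\<delta>\<bar>) \<le> real m * 1" using that by (simp add: n_def abs_mult power2_eq_square mult.assoc)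
    then have "real m * \<bar>\<delta>\<bar> \<le> 1" using that by (subst (asm) mult_le_cancel_left_pos) auto
    then show ?thesis using that by (simp add: field_simps)
  qed
  have "\<bar>\<delta>\<bar> \<le> 1 / real (Suc m)" for m by (rule small) simp
  moreover have "(\<lambda>m. 1 / real (Suc m)) \<longlonglongrightarrow> 0" using LIMSEQ_inverse_real_of_nat by (simp add: inverse_eq_divide)
  ultimately have "\<bar>\<delta>\<bar> \<le> 0" by (intro LIMSEQ_le_const) auto
  then show ?thesis using p J by (simp add: \<delta>_def c_def prob_all_open)
qed

text \<open>Independence of \<open>A\<close> from every cylinder event makes the measure restricted
  to \<open>A\<close> equal to P(A) times the whole measure. Evaluated at \<open>A\<close> itself,
  this says P(A) = P(A)^2.\<close>

lemma invariant_zero_one: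
  assumes p: "0 \<le> p" "p \<le> 1" and A: "A \<in> sets config_space"
    and inv: "\<And>v. translate v -` A \<inter> space config_space = A"
  shows "measure (bond_percolation p) A = 0 \<or> measure (bond_percolation p) A = 1"
proof -
  let ?M = "bond_percolation p"
  interpret prob_space ?M by (rule prob_space_bond_percolation)
  have dens: "emeasure (density ?M (indicator A)) B = emeasure ?M (A \<inter> B)" if "B \<in> sets config_space" for B
    using that A by (intro emeasure_restricted) (auto simp: sets_bond_percolation)
  have "density ?M (indicator A) = scale_measure (emeasure ?M A) ?M"
  proof (rule config_measure_eqI)
    show "emeasure (density ?M (indicator A)) (space (density ?M (indicator A))) \<noteq> \<infinity>"
      using dens[of "space config_space"] by (simp add: space_bond_percolation)
    fix J :: "(int ^ 'a) set set" assume J: "finite J" "J \<subseteq> lattice_edges"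
    show "emeasure (density ?M (indicator A)) (all_open J) = emeasure (scale_measure (emeasure ?M A) ?M) (all_open J)"
      using invariant_Int_all_open[OF p J A inv] J
      by (subst dens) (simp_all add: emeasure_eq_measure ennreal_mult)
  qed (simp_all add: sets_bond_percolation)
  then have "emeasure ?M A = emeasure ?M A * emeasure ?M A" using dens[OF A] by simp
  then have "prob A = prob A * prob A" by (simp add: emeasure_eq_measure flip: ennreal_mult)
  then show ?thesis by simp
qed

lemma invariant_AE_const:
  fixes f :: "'d::finite config \<Rightarrow> ereal"
  assumes p: "0 \<le> p" "p \<le> 1" and f [measurable]: "f \<in> borel_measurable config_space"
    and inv: "\<And>v \<omega>. \<omega> \<in> space config_space \<Longrightarrow> f (translate v \<omega>) = f \<omega>"
  shows "\<exists>c. AE \<omega> in bond_percolation p. f \<omega> = c"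
proof -
  let ?M = "bond_percolation p"
  interpret prob_space ?M by (rule prob_space_bond_percolation)
  have dich: "(AE \<omega> in ?M. f \<omega> \<le> r) \<or> (AE \<omega> in ?M. \<not> f \<omega> \<le> r)" for r
  proof -
    let ?A = "{\<omega> \<in> space config_space. f \<omega> \<le> r}"
    have A: "?A \<in> sets config_space" by measurable
    have "prob ?A = 0 \<or> prob ?A = 1"
      using p A by (rule invariant_zero_one)
        (use inv measurable_space[OF measurable_translate] in auto)
    moreover have Aev: "?A \<in> events" using A by (simp add: sets_bond_percolation)
    ultimately consider "AE \<omega> in ?M. \<omega> \<notin> ?A" | "AE \<omega> in ?M. \<omega> \<in> ?A"
      using prob_eq_0[OF Aev] prob_eq_1[OF Aev] by blast
    then show ?thesis
    proof cases
      case 1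
      then have "AE \<omega> in ?M. \<not> f \<omega> \<le> r"
        using AE_space by eventually_elim (auto simp: space_bond_percolation)
      then show ?thesis ..
    next
      case 2
      then have "AE \<omega> in ?M. f \<omega> \<le> r" by eventually_elim auto
      then show ?thesis ..
    qed
  qed
  \<comment> \<open>The essential supremum of \<open>f\<close>. Only rational levels are used, so
    that the exceptional null sets of all levels can be united.\<close>
  define c where "c = Inf {ereal r | r. r \<in> \<rat> \<and> (AE \<omega> in ?M. f \<omega> \<le> ereal r)}"
  have "AE \<omega> in ?M. \<forall>r\<in>\<rat>. ((AE \<omega> in ?M. f \<omega> \<le> ereal r) \<longrightarrow> f \<omega> \<le> ereal r) \<and>
      (\<not> (AE \<omega> in ?M. f \<omega> \<le> ereal r) \<longrightarrow> \<not> f \<omega> \<le> ereal r)"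
  proof (subst AE_ball_countable[OF countable_rat], intro ballI)
    fix r :: real
    show "AE \<omega> in ?M. ((AE \<omega> in ?M. f \<omega> \<le> ereal r) \<longrightarrow> f \<omega> \<le> ereal r) \<and>
      (\<not> (AE \<omega> in ?M. f \<omega> \<le> ereal r) \<longrightarrow> \<not> f \<omega> \<le> ereal r)"
      using dich[of "ereal r"] by (cases "AE \<omega> in ?M. f \<omega> \<le> ereal r") auto
  qed
  then have "AE \<omega> in ?M. f \<omega> = c"
  proof (rule eventually_mono)
    fix \<omega> assume *: "\<forall>r\<in>\<rat>. ((AE \<omega> in ?M. f \<omega> \<le> ereal r) \<longrightarrow> f \<omega> \<le> ereal r) \<and>
      (\<not> (AE \<omega> in ?M. f \<omega> \<le> ereal r) \<longrightarrow> \<not> f \<omega> \<le> ereal r)"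
    have "f \<omega> \<le> c" unfolding c_def using * by (auto intro!: Inf_greatest)
    moreover have "c \<le> f \<omega>"
    proof (rule ccontr)
      assume "\<not> c \<le> f \<omega>"
      then have "f \<omega> < c" by simp
      then obtain r where r: "f \<omega> < ereal (real_of_rat r)" "ereal (real_of_rat r) < c"
        using ereal_dense3 by blast
      then have "AE \<omega> in ?M. f \<omega> \<le> ereal (real_of_rat r)" using *[rule_format, of "real_of_rat r"] by auto
      then have "c \<le> ereal (real_of_rat r)" unfolding c_def by (intro Inf_lower) auto
      then show False using r by simp
    qed
    ultimately show "f \<omega> = c" by simp
  qed
  then show ?thesis by auto
qed

section \<open>Uniqueness of the infinite cluster\<close>

definition separated :: "('a \<Rightarrow> 'a \<Rightarrow> bool) \<Rightarrow> 'a set \<Rightarrow> bool" where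
  "separated R V \<longleftrightarrow> (\<forall>x\<in>V. infinite {y. R\<^sup>*\<^sup>* x y}) \<and> pairwise (\<lambda>x y. \<not> R\<^sup>*\<^sup>* x y) V"

text \<open>At least k infinite clusters, witnessed by one vertex in each. The finite witness sets
  form a countable family, which makes the event measurable.\<close>

definition many_clusters :: "nat \<Rightarrow> ('a \<Rightarrow> 'a \<Rightarrow> bool) \<Rightarrow> bool" where
  "many_clusters k R \<longleftrightarrow> (\<exists>V. finite V \<and> card V = k \<and> separated R V)"

text \<open>Without the edges inside \<open>Q\<close>, an infinite cluster that meets
  \<open>Q\<close> is covered by the pieces containing one of the finitely many vertices of
  \<open>Q\<close>, so some piece is infinite. Pieces of different clusters stay apart because
  severing only deletes edges.\<close>

lemma separated_sever:
  assumes "symp R" "separated R V" "V \<subseteq> Q" "finite Q"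
  shows "\<exists>V'\<subseteq>Q. card V' = card V \<and> separated (sever {Q} R) V'"
proof -
  have "\<exists>q\<in>Q. R\<^sup>*\<^sup>* x q \<and> infinite {y. (sever {Q} R)\<^sup>*\<^sup>* q y}" if x: "x \<in> V" for x
  proof (rule ccontr)
    assume no: "\<not> ?thesis"
    have "{y. R\<^sup>*\<^sup>* x y} \<subseteq> (\<Union>q\<in>{q \<in> Q. R\<^sup>*\<^sup>* x q}. {y. (sever {Q} R)\<^sup>*\<^sup>* q y})"
    proof clarify
      fix y assume y: "R\<^sup>*\<^sup>* x y"
      have "(sever {Q} R)\<^sup>*\<^sup>* y x \<or> (\<exists>u\<in>Q. (sever {Q} R)\<^sup>*\<^sup>* y u)"
        by (rule rtranclp_sever_hit[OF rtranclp_commute[OF assms(1) y]])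
      then obtain u where u: "u \<in> Q" "(sever {Q} R)\<^sup>*\<^sup>* y u" using x assms(3) by auto
      have "R\<^sup>*\<^sup>* y u" using rtranclp_sever_mono[OF u(2), of "{}"] by simp
      then have "R\<^sup>*\<^sup>* x u" using y by auto
      moreover have "(sever {Q} R)\<^sup>*\<^sup>* u y" by (rule rtranclp_commute[OF symp_sever[OF assms(1)] u(2)])
      ultimately show "y \<in> (\<Union>q\<in>{q \<in> Q. R\<^sup>*\<^sup>* x q}. {y. (sever {Q} R)\<^sup>*\<^sup>* q y})" using u by auto
    qed
    moreover have "finite (\<Union>q\<in>{q \<in> Q. R\<^sup>*\<^sup>* x q}. {y. (sever {Q} R)\<^sup>*\<^sup>* q y})" using no assms(4) by auto
    ultimately show False using finite_subset assms(2) x by (auto simp: separated_def)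
  qed
  then obtain f where f: "\<And>x. x \<in> V \<Longrightarrow> f x \<in> Q \<and> R\<^sup>*\<^sup>* x (f x) \<and> infinite {y. (sever {Q} R)\<^sup>*\<^sup>* (f x) y}"
    by metis
  have link: "x = y" if "x \<in> V" "y \<in> V" "R\<^sup>*\<^sup>* (f x) (f y)" for x y
  proof -
    have "R\<^sup>*\<^sup>* (f y) y" using f[OF that(2)] rtranclp_commute[OF assms(1)] by blast
    then have "R\<^sup>*\<^sup>* x y" using f[OF that(1)] that(3) by (meson rtranclp_trans)
    then show ?thesis using assms(2) that by (auto simp: separated_def pairwise_def)
  qed
  have "inj_on f V" using link by (auto intro!: inj_onI)
  moreover have "separated (sever {Q} R) (f ` V)"
    unfolding separated_def pairwise_def
  proof (intro conjI ballI impI notI)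
    show False if ab: "a \<in> f ` V" "b \<in> f ` V" "a \<noteq> b" "(sever {Q} R)\<^sup>*\<^sup>* a b" for a b
      using ab rtranclp_sever_mono[OF ab(4), of "{}"] link by auto
  qed (use f in auto)
  ultimately show ?thesis using f by (intro exI[of _ "f ` V"]) (auto simp: card_image)
qed

text \<open>\<open>R'\<close> arises from \<open>R\<close> by joining up \<open>Q\<close>. An
  infinite \<open>R'\<close>-cluster that misses \<open>Q\<close> is an infinite
  \<open>R\<close>-cluster distinct from those of \<open>V\<close>, which would be one too many. So
  every infinite \<open>R'\<close>-cluster meets \<open>Q\<close>, and \<open>Q\<close> lies in a
  single \<open>R'\<close>-cluster.\<close>

lemma not_many_clusters_merge:
  assumes sub: "\<And>x y. R x y \<Longrightarrow> R' x y" and eq: "sever {Q} R' = sever {Q} R" and symp: "symp R'"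
    and conn: "\<And>x y. x \<in> Q \<Longrightarrow> y \<in> Q \<Longrightarrow> R'\<^sup>*\<^sup>* x y"
    and V: "separated R V" "V \<subseteq> Q" "finite V" "V \<noteq> {}" and max: "\<not> many_clusters (Suc (card V)) R"
  shows "\<not> many_clusters 2 R'"
proof
  assume "many_clusters 2 R'"
  then obtain a b where ab: "a \<noteq> b" "separated R' {a, b}"
    by (auto simp: many_clusters_def card_2_iff)
  obtain x where x: "x \<in> V" using V(4) by auto
  have mono: "R'\<^sup>*\<^sup>* u w" if "R\<^sup>*\<^sup>* u w" for u w using that sub by (rule mono_rtranclp[rule_format, rotated])
  have "\<not> R'\<^sup>*\<^sup>* a b" using ab by (auto simp: separated_def pairwise_def)
  then have "\<not> R'\<^sup>*\<^sup>* a x \<or> \<not> R'\<^sup>*\<^sup>* b x" using rtranclp_commute[OF symp] by (meson rtranclp_trans)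
  then obtain c where c: "infinite {y. R'\<^sup>*\<^sup>* c y}" "\<not> R'\<^sup>*\<^sup>* c x" using ab(2) by (auto simp: separated_def)
  have away: "u \<notin> Q" if "R'\<^sup>*\<^sup>* c u" for u
    using conn[of u x] c(2) that x V(2) by (meson rtranclp_trans subsetD)
  have "R\<^sup>*\<^sup>* c u" if "R'\<^sup>*\<^sup>* c u" for u
  proof -
    have "(sever {Q} R')\<^sup>*\<^sup>* c u" by (rule rtranclp_sever_avoid[OF that]) (use away in auto)
    then have "(sever {Q} R)\<^sup>*\<^sup>* c u" by (simp add: eq)
    then show ?thesis using rtranclp_sever_mono[of "{Q}" R c u "{}"] by simp
  qed
  then have inf: "infinite {y. R\<^sup>*\<^sup>* c y}" using c(1) mono by (metis (no_types, lifting) Collect_cong)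
  have no1: "\<not> R\<^sup>*\<^sup>* c v" if "v \<in> V" for v using away[of v] mono that V(2) by blast
  have no2: "\<not> R\<^sup>*\<^sup>* v c" if "v \<in> V" for v
  proof
    assume "R\<^sup>*\<^sup>* v c"
    then have "R'\<^sup>*\<^sup>* c v" using mono rtranclp_commute[OF symp] by blast
    then show False using away that V(2) by blast
  qed
  have "separated R (insert c V)"
    using V(1) inf no1 no2 by (auto simp: separated_def pairwise_insert)
  moreover have "c \<notin> V" using no1 by blast
  ultimately have "many_clusters (Suc (card V)) R"
    unfolding many_clusters_def using V(3) by (intro exI[of _ "insert c V"]) simp
  then show False using max by simp
qed

subsection \<open>Measurability\<close>

lemma pred_open_adj [measurable]: "Measurable.pred config_space (\<lambda>\<omega>. open_adj \<omega> x y)"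
proof (cases "lattice_adj x y")
  case True
  then have "{x, y} \<in> lattice_edges" by (auto simp: lattice_edges_def)
  then show ?thesis using True by (simp add: open_adj_def)
qed (simp add: open_adj_def)

lemma pred_sever: "Measurable.pred M (\<lambda>\<omega>. R \<omega> x y) \<Longrightarrow> Measurable.pred M (\<lambda>\<omega>. sever T (R \<omega>) x y)"
  by (cases "\<forall>Q\<in>T. \<not> (x \<in> Q \<and> y \<in> Q)") (simp_all add: sever_def)

text \<open>Reachability is a countable union over the number of steps and, for each number, over
  the intermediate vertices.\<close>

lemma pred_rtranclp:
  fixes R :: "'b \<Rightarrow> 'a::countable \<Rightarrow> 'a \<Rightarrow> bool"
  assumes [measurable]: "\<And>x y. Measurable.pred M (\<lambda>\<omega>. R \<omega> x y)"
  shows "Measurable.pred M (\<lambda>\<omega>. (R \<omega>)\<^sup>*\<^sup>* x y)"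
proof -
  have "Measurable.pred M (\<lambda>\<omega>. (R \<omega> ^^ n) x y)" for n y
  proof (induction n arbitrary: y)
    case (Suc n)
    note [measurable] = Suc
    have "(R \<omega> ^^ Suc n) x y \<longleftrightarrow> (\<exists>z. (R \<omega> ^^ n) x z \<and> R \<omega> z y)" for \<omega> by auto
    then show ?case by (simp only:) measurable
  qed simp
  note [measurable] = this
  show ?thesis unfolding rtranclp_power by measurable
qed

text \<open>Turns infinitude into countable quantification, from which measurability can be read
  off.\<close>

lemma infinite_iff_to_nat: "infinite S \<longleftrightarrow> (\<forall>n. \<exists>y. y \<in> S \<and> to_nat (y :: 'a::countable) > n)"
proof -
  have "infinite S \<longleftrightarrow> infinite (to_nat ` S)" by (simp add: finite_image_iff)
  also have "\<dots> \<longleftrightarrow> (\<forall>n. \<exists>y. y \<in> S \<and> to_nat y > n)"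
    unfolding infinite_nat_iff_unbounded by (intro iff_allI iffI) blast+
  finally show ?thesis .
qed

lemma pred_infinite_rtranclp:
  fixes R :: "'b \<Rightarrow> 'a::countable \<Rightarrow> 'a \<Rightarrow> bool"
  assumes "\<And>x y. Measurable.pred M (\<lambda>\<omega>. R \<omega> x y)"
  shows "Measurable.pred M (\<lambda>\<omega>. infinite {y. (R \<omega>)\<^sup>*\<^sup>* x y})"
proof -
  note [measurable] = pred_rtranclp[OF assms]
  show ?thesis unfolding infinite_iff_to_nat mem_Collect_eq by measurable
qed

lemma pred_separated:
  fixes R :: "'b \<Rightarrow> 'a::countable \<Rightarrow> 'a \<Rightarrow> bool"
  assumes "\<And>x y. Measurable.pred M (\<lambda>\<omega>. R \<omega> x y)" and "finite V"
  shows "Measurable.pred M (\<lambda>\<omega>. separated (R \<omega>) V)"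
proof -
  have "Measurable.pred M (\<lambda>\<omega>. \<forall>x\<in>V. infinite {y. (R \<omega>)\<^sup>*\<^sup>* x y})"
    using assms by (intro pred_intros_finite(3) pred_infinite_rtranclp)
  moreover have "Measurable.pred M (\<lambda>\<omega>. x \<noteq> y \<longrightarrow> \<not> (R \<omega>)\<^sup>*\<^sup>* x y)" for x y
    using pred_rtranclp[of R M x y] assms(1) by (cases "x = y") (auto intro: pred_intros_logic)
  then have "Measurable.pred M (\<lambda>\<omega>. \<forall>x\<in>V. \<forall>y\<in>V. x \<noteq> y \<longrightarrow> \<not> (R \<omega>)\<^sup>*\<^sup>* x y)"
    using assms(2) by (intro pred_intros_finite(3))
  ultimately show ?thesis unfolding separated_def pairwise_def by (rule pred_intros_logic)
qed

lemma pred_many_clusters: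
  fixes R :: "'b \<Rightarrow> 'a::countable \<Rightarrow> 'a \<Rightarrow> bool"
  assumes "\<And>x y. Measurable.pred M (\<lambda>\<omega>. R \<omega> x y)"
  shows "Measurable.pred M (\<lambda>\<omega>. many_clusters k (R \<omega>))"
proof (rule pred_def[THEN iffD2])
  have eq: "{\<omega> \<in> space M. many_clusters k (R \<omega>)} =
      (\<Union>V\<in>{V. finite V \<and> card V = k}. {\<omega> \<in> space M. separated (R \<omega>) V})"
    by (auto simp: many_clusters_def)
  have "countable {V :: 'a set. finite V \<and> card V = k}"
    by (rule countable_subset[OF _ countable_Collect_finite]) auto
  then show "{\<omega> \<in> space M. many_clusters k (R \<omega>)} \<in> sets M"
    unfolding eq by (rule sets.countable_UN'') (auto intro: predE[OF pred_separated] assms)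
qed

subsection \<open>Boxes\<close>

text \<open>Half-open in every coordinate, so that the side length is b - a and the translates of
  \<open>cube (- L) L\<close> by multiples of 2 L are disjoint.\<close>

definition cube :: "int \<Rightarrow> int \<Rightarrow> (int ^ 'd::finite) set" where
  "cube a b = {x. \<forall>i. a \<le> x $ i \<and> x $ i < b}"

lemma finite_cube: "finite (cube a b :: (int ^ 'd::finite) set)"
proof -
  have "cube a b = {x :: int ^ 'd. \<forall>i. x $ i \<in> {a..<b}}" by (auto simp: cube_def)
  moreover have "finite {x :: int ^ 'd. \<forall>i. x $ i \<in> {a..<b}}" by (rule finite_vec_PiE) simp
  ultimately show ?thesis by (simp only:)
qed

lemma card_cube: "card (cube a b :: (int ^ 'd::finite) set) = nat (b - a) ^ CARD('d)"
proof -
  have "bij_betw (\<lambda>f. vec_lambda f) (PiE (UNIV :: 'd set) (\<lambda>_. {a..<b})) (cube a b :: (int ^ 'd) set)"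
    by (rule bij_betw_byWitness[of _ vec_nth]) (auto simp: cube_def vec_lambda_inverse vec_nth_inverse PiE_iff)
  then have "card (cube a b :: (int ^ 'd) set) = card (PiE (UNIV :: 'd set) (\<lambda>_. {a..<b}))"
    by (simp add: bij_betw_same_card)
  also have "\<dots> = nat (b - a) ^ CARD('d)" by (simp add: card_PiE)
  finally show ?thesis .
qed

lemma finite_subset_cube:
  fixes V :: "(int ^ 'd::finite) set"
  assumes "finite V"
  obtains L where "L \<ge> 1" "V \<subseteq> cube (- L) L"
proof
  define L where "L = 1 + (\<Sum>x\<in>V. \<Sum>i\<in>UNIV. \<bar>x $ i\<bar>)"
  show "L \<ge> 1" by (simp add: L_def sum_nonneg)
  show "V \<subseteq> cube (- L) L"
  proof
    fix x assume "x \<in> V"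
    have "\<bar>x $ i\<bar> < L" for i
    proof -
      have "\<bar>x $ i\<bar> \<le> (\<Sum>i\<in>UNIV. \<bar>x $ i\<bar>)" by (rule member_le_sum) auto
      also have "\<dots> \<le> (\<Sum>x\<in>V. \<Sum>i\<in>UNIV. \<bar>x $ i\<bar>)"
        using assms \<open>x \<in> V\<close> by (intro member_le_sum) (auto simp: sum_nonneg)
      finally show ?thesis by (simp add: L_def)
    qed
    then show "x \<in> cube (- L) L" by (auto simp: cube_def abs_less_iff) (smt (verit))
  qed
qed

definition box_edges :: "(int ^ 'd) set \<Rightarrow> (int ^ 'd::finite) set set" where
  "box_edges Q = {e \<in> lattice_edges. e \<subseteq> Q}"

lemma finite_box_edges: "finite Q \<Longrightarrow> finite (box_edges Q)"
  by (rule finite_subset[of _ "Pow Q"]) (auto simp: box_edges_def)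

lemma box_edges_subset: "box_edges Q \<subseteq> lattice_edges"
  by (auto simp: box_edges_def)

text \<open>Every point of a cube is joined to the lowest corner by decreasing its coordinates.\<close>

lemma cube_connected:
  assumes "x \<in> cube a b" "y \<in> cube a b"
  shows "(\<lambda>x y. lattice_adj x y \<and> x \<in> cube a b \<and> y \<in> cube a b)\<^sup>*\<^sup>* x (y :: int ^ 'd::finite)"
proof -
  let ?R = "\<lambda>x y. lattice_adj x y \<and> x \<in> cube a b \<and> y \<in> (cube a b :: (int ^ 'd) set)"
  have sym: "symp ?R" by (auto simp: symp_def lattice_adj_commute)
  have "?R\<^sup>*\<^sup>* x (\<chi> i. a)" if "x \<in> cube a b" for x :: "int ^ 'd"
    using that
  proof (induction "nat (\<Sum>i\<in>UNIV. x $ i - a)" arbitrary: x rule: less_induct)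
    case less
    show ?case
    proof (cases "x = (\<chi> i. a)")
      case False
      then obtain k where k: "x $ k \<noteq> a" by (auto simp: vec_eq_iff)
      then have ak: "a < x $ k" using less.prems by (auto simp: cube_def order_less_le)
      define y where "y = x + axis k (-1)"
      have yi: "y $ i = x $ i + (if i = k then - 1 else 0)" for i by (simp add: y_def axis_def)
      have y: "y \<in> cube a b" using less.prems ak by (auto simp: cube_def yi) (smt (verit))
      have "(\<Sum>i\<in>UNIV. y $ i - a) = (\<Sum>i\<in>UNIV. x $ i - a) - 1"
        by (simp add: yi sum.distrib sum_subtractf)
      moreover have "x $ k - a \<le> (\<Sum>i\<in>UNIV. x $ i - a)"
        using less.prems by (intro member_le_sum) (auto simp: cube_def)
      ultimately have "nat (\<Sum>i\<in>UNIV. y $ i - a) < nat (\<Sum>i\<in>UNIV. x $ i - a)"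
        using ak by linarith
      from less.hyps[OF this y] have "?R\<^sup>*\<^sup>* y (\<chi> i. a)" .
      moreover have "x = y + axis k 1" by (simp add: vec_eq_iff yi axis_def)
      then have "lattice_adj x y" using lattice_adj_add_axis[of y k] lattice_adj_commute by metis
      ultimately show ?thesis using y less.prems by (intro converse_rtranclp_into_rtranclp[of ?R x y]) auto
    qed simp
  qed
  from this[OF assms(1)] rtranclp_commute[OF sym this[OF assms(2)]] show ?thesis by (rule rtranclp_trans)
qed

lemma cube_open_connected:
  assumes "\<omega> \<in> all_open (box_edges Q)"
    and "\<And>x y. x \<in> Q \<Longrightarrow> y \<in> Q \<Longrightarrow> (\<lambda>x y. lattice_adj x y \<and> x \<in> Q \<and> y \<in> Q)\<^sup>*\<^sup>* x y"
    and "x \<in> Q" "y \<in> Q"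
  shows "(\<lambda>x y. open_adj \<omega> x y \<and> x \<in> Q \<and> y \<in> Q)\<^sup>*\<^sup>* x y"
  using assms(2)[OF assms(3,4)]
proof (rule mono_rtranclp[rule_format, rotated])
  fix x y assume xy: "lattice_adj x y \<and> x \<in> Q \<and> y \<in> Q"
  then have "{x, y} \<in> box_edges Q" by (auto simp: box_edges_def lattice_edges_def)
  then show "open_adj \<omega> x y \<and> x \<in> Q \<and> y \<in> Q"
    using xy assms(1) by (auto simp: open_adj_def all_open_def)
qed

lemma open_adj_open_up:
  "open_adj (open_up (box_edges Q) \<omega>) x y \<longleftrightarrow> open_adj \<omega> x y \<or> (lattice_adj x y \<and> x \<in> Q \<and> y \<in> Q)"
  by (auto simp: open_adj_def open_up_def box_edges_def lattice_edges_def)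

lemma sever_open_up: "sever {Q} (open_adj (open_up (box_edges Q) \<omega>)) = sever {Q} (open_adj \<omega>)"
  by (auto simp: sever_def open_adj_open_up fun_eq_iff)

lemma open_up_in_all_open:
  "J \<subseteq> lattice_edges \<Longrightarrow> open_up J \<omega> \<in> all_open J"
  by (auto simp: open_up_def all_open_def space_config_space)

subsection \<open>Translation invariance\<close>

lemma rtranclp_translate:
  fixes v :: "'a::ab_group_add"
  assumes "\<And>a b. R' a b \<longleftrightarrow> R (v + a) (v + b)"
  shows "R'\<^sup>*\<^sup>* a b \<longleftrightarrow> R\<^sup>*\<^sup>* (v + a) (v + b)"
proof
  show "R\<^sup>*\<^sup>* (v + a) (v + b)" if "R'\<^sup>*\<^sup>* a b"
    using that by induction (auto simp: assms intro: rtranclp.rtrancl_into_rtrancl)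
  have "R'\<^sup>*\<^sup>* a (w - v)" if "R\<^sup>*\<^sup>* (v + a) w" for w
    using that
  proof induction
    case (step y z)
    then have "R' (y - v) (z - v)" by (simp add: assms)
    then show ?case using step by (meson rtranclp.rtrancl_into_rtrancl)
  qed simp
  from this[of "v + b"] show "R'\<^sup>*\<^sup>* a b" if "R\<^sup>*\<^sup>* (v + a) (v + b)" using that by simp
qed

lemma infinite_rtranclp_translate:
  fixes v :: "'a::ab_group_add"
  assumes "\<And>a b. R' a b \<longleftrightarrow> R (v + a) (v + b)"
  shows "infinite {y. R'\<^sup>*\<^sup>* a y} \<longleftrightarrow> infinite {y. R\<^sup>*\<^sup>* (v + a) y}"
proof -
  have "{y. R\<^sup>*\<^sup>* (v + a) y} = (+) v ` {y. R'\<^sup>*\<^sup>* a y}"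
  proof (intro equalityI subsetI)
    fix y assume "y \<in> {y. R\<^sup>*\<^sup>* (v + a) y}"
    then show "y \<in> (+) v ` {y. R'\<^sup>*\<^sup>* a y}"
      using rtranclp_translate[of R' R v, OF assms, of a "y - v"] by (intro image_eqI[of _ _ "y - v"]) auto
  next
    fix y assume "y \<in> (+) v ` {y. R'\<^sup>*\<^sup>* a y}"
    then show "y \<in> {y. R\<^sup>*\<^sup>* (v + a) y}"
      using rtranclp_translate[of R' R v, OF assms, of a] by auto
  qed
  then show ?thesis by (simp add: finite_image_iff)
qed

lemma separated_translate:
  fixes v :: "'a::ab_group_add"
  assumes "\<And>a b. R' a b \<longleftrightarrow> R (v + a) (v + b)"
  shows "separated R' V \<longleftrightarrow> separated R ((+) v ` V)"
  unfolding separated_def pairwise_def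
  by (simp add: infinite_rtranclp_translate[of R' R v, OF assms] rtranclp_translate[of R' R v, OF assms])

lemma many_clusters_translate:
  fixes v :: "'a::ab_group_add"
  assumes "\<And>a b. R' a b \<longleftrightarrow> R (v + a) (v + b)"
  shows "many_clusters k R' \<longleftrightarrow> many_clusters k R"
proof -
  have 1: "many_clusters k R2" if many: "many_clusters k R1" and R12: "\<And>a b. R1 a b \<longleftrightarrow> R2 (u + a) (u + b)"
    for R1 R2 and u :: 'a
  proof -
    obtain V where "finite V" "card V = k" "separated R1 V" using many unfolding many_clusters_def by blast
    then show ?thesis unfolding many_clusters_def
      using separated_translate[of R1 R2 u, OF R12] by (intro exI[of _ "(+) u ` V"]) (auto simp: card_image)
  qed
  show ?thesis using 1[of R' R v] 1[of R R' "- v"] assms by auto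
qed

lemma many_clusters_zero_one:
  assumes p: "0 \<le> p" "p \<le> 1"
  shows "(AE \<omega> in bond_percolation p. many_clusters k (open_adj (\<omega> :: 'd::finite config))) \<or>
    (AE \<omega> in bond_percolation p. \<not> many_clusters k (open_adj (\<omega> :: 'd::finite config)))"
proof -
  let ?A = "{\<omega> :: 'd config \<in> space config_space. many_clusters k (open_adj \<omega>)}"
  interpret prob_space "bond_percolation p :: 'd config measure" by (rule prob_space_bond_percolation)
  have A: "?A \<in> sets config_space" by (rule predE[OF pred_many_clusters]) simp
  then have Aev: "?A \<in> events" by (simp add: sets_bond_percolation)
  have "prob ?A = 0 \<or> prob ?A = 1"
  proof (rule invariant_zero_one[OF p A])
    fix v :: "int ^ 'd"
    have "many_clusters k (open_adj (translate v \<omega>)) \<longleftrightarrow> many_clusters k (open_adj \<omega>)" for \<omega>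
      by (rule many_clusters_translate[of _ _ v]) (simp add: open_adj_translate)
    then show "translate v -` ?A \<inter> space config_space = ?A"
      using measurable_space[OF measurable_translate] by auto
  qed
  then consider "AE \<omega> in bond_percolation p. \<omega> \<notin> ?A" | "AE \<omega> in bond_percolation p. \<omega> \<in> ?A"
    using prob_eq_0[OF Aev] prob_eq_1[OF Aev] by blast
  then show ?thesis
  proof cases
    case 1
    then have "AE \<omega> in bond_percolation p. \<not> many_clusters k (open_adj (\<omega> :: 'd config))"
      using AE_space by eventually_elim (auto simp: space_bond_percolation)
    then show ?thesis ..
  next
    case 2
    then have "AE \<omega> in bond_percolation p. many_clusters k (open_adj (\<omega> :: 'd config))" by eventually_elim auto
    then show ?thesis ..
  qed
qed

text \<open>There are only countably many candidates for the witness set, so one deterministic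
  \<open>V\<close> must work with positive probability. This \<open>V\<close> later fixes the size
  of the box.\<close>

lemma not_AE_many_clustersD:
  fixes P :: "'d::finite config \<Rightarrow> bool"
  assumes "\<not> (AE \<omega> in bond_percolation p. \<not> (many_clusters k (open_adj \<omega>) \<and> P \<omega>))"
  shows "\<exists>V. finite V \<and> card V = k \<and> \<not> (AE \<omega> in bond_percolation p. \<not> (separated (open_adj \<omega>) V \<and> P \<omega>))"
proof (rule ccontr)
  assume no: "\<not> ?thesis"
  have "countable {V :: (int ^ 'd) set. finite V \<and> card V = k}"
    by (rule countable_subset[OF _ countable_Collect_finite]) auto
  then have "AE \<omega> in bond_percolation p. \<forall>V\<in>{V. finite V \<and> card V = k}. \<not> (separated (open_adj \<omega>) V \<and> P \<omega>)"
    using no by (subst AE_ball_countable) auto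
  then have "AE \<omega> in bond_percolation p. \<not> (many_clusters k (open_adj \<omega>) \<and> P \<omega>)"
    by eventually_elim (auto simp: many_clusters_def)
  then show False using assms by simp
qed

subsection \<open>Counting trifurcation boxes\<close>

text \<open>The open inner edges provide the connectedness that
  \<open>trifurcation_representatives\<close> asks for. The second condition ignores the inner edges
  and is therefore unaffected by opening them.\<close>

definition trifurcation :: "(int ^ 'd::finite) set \<Rightarrow> 'd config \<Rightarrow> bool" where
  "trifurcation Q \<omega> \<longleftrightarrow> \<omega> \<in> all_open (box_edges Q) \<and>
     (\<exists>V\<subseteq>Q. card V = 3 \<and> separated (sever {Q} (open_adj \<omega>)) V)"

definition tile :: "int \<Rightarrow> int ^ 'd \<Rightarrow> (int ^ 'd::finite) set" where
  "tile L z = (+) (\<chi> i. 2 * L * z $ i) ` cube (- L) L"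

lemma in_tile_iff: "x \<in> tile L z \<longleftrightarrow> (\<forall>i. 2 * L * z $ i - L \<le> x $ i \<and> x $ i < 2 * L * z $ i + L)"
proof -
  have "x \<in> tile L z \<longleftrightarrow> x - (\<chi> i. 2 * L * z $ i) \<in> cube (- L) L"
    unfolding tile_def by (auto intro: image_eqI[of _ _ "x - (\<chi> i. 2 * L * z $ i)"])
  then show ?thesis by (auto simp: cube_def algebra_simps)
qed

lemma tile_0: "tile L 0 = cube (- L) L"
  by (auto simp: in_tile_iff cube_def)

lemma disjoint_tiles:
  assumes "L \<ge> 1" "z \<noteq> w"
  shows "tile L z \<inter> tile L w = {}"
proof -
  have less: False if "z $ i < w $ i" "x \<in> tile L z" "x \<in> tile L w" for x z w :: "int ^ 'a" and i
  proof -
    have "L * (z $ i + 1) \<le> L * w $ i" using that(1) assms(1) by (intro mult_left_mono) auto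
    moreover have "x $ i < 2 * L * z $ i + L" "2 * L * w $ i - L \<le> x $ i"
      using that(2,3) by (auto simp: in_tile_iff)
    ultimately show False by (simp add: algebra_simps)
  qed
  obtain i where "z $ i \<noteq> w $ i" using assms(2) by (auto simp: vec_eq_iff)
  then have "z $ i < w $ i \<or> w $ i < z $ i" by auto
  then show ?thesis using less by blast
qed

lemma tile_subset_cube:
  assumes "L \<ge> 1" "z \<in> cube 0 n"
  shows "tile L z \<subseteq> cube (- L) (2 * L * n - L)"
proof
  fix x assume x: "x \<in> tile L z"
  have "- L \<le> x $ i \<and> x $ i < 2 * L * n - L" for i
  proof -
    have z: "0 \<le> z $ i" "z $ i + 1 \<le> n" using assms(2) by (auto simp: cube_def add1_zle_eq)
    have "0 \<le> L * z $ i" using z assms(1) by simp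
    moreover have "L * (z $ i + 1) \<le> L * n" using z assms(1) by (intro mult_left_mono) auto
    moreover have "2 * L * z $ i - L \<le> x $ i" "x $ i < 2 * L * z $ i + L" using x by (auto simp: in_tile_iff)
    ultimately show ?thesis by (simp add: algebra_simps)
  qed
  then show "x \<in> cube (- L) (2 * L * n - L)" by (auto simp: cube_def)
qed

lemma tile_connected:
  assumes "x \<in> tile L z" "y \<in> tile L z"
  shows "(\<lambda>x y. lattice_adj x y \<and> x \<in> tile L z \<and> y \<in> tile L z)\<^sup>*\<^sup>* x y"
proof -
  let ?v = "\<chi> i. 2 * L * z $ i"
  obtain a b where ab: "a \<in> cube (- L) L" "b \<in> cube (- L) L" "x = ?v + a" "y = ?v + b"
    using assms by (auto simp: tile_def)
  let ?R' = "\<lambda>a b. lattice_adj a b \<and> a \<in> cube (- L) L \<and> b \<in> cube (- L) L"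
  let ?R = "\<lambda>a b. lattice_adj a b \<and> a \<in> tile L z \<and> b \<in> tile L z"
  have "?R' a b \<longleftrightarrow> ?R (?v + a) (?v + b)" for a b
    by (auto simp: tile_def lattice_adj_translate)
  from rtranclp_translate[of ?R' ?R ?v, OF this, of a b] cube_connected[OF ab(1,2)] show ?thesis
    by (simp add: ab)
qed

text \<open>An infinite cluster leaves the finite cube, and the first vertex outside lies in the
  surrounding layer of width one, because a step changes each coordinate by at most 1.\<close>

lemma infinite_cluster_leaves_cube:
  assumes "infinite {y. R\<^sup>*\<^sup>* v y}" "\<And>x y. R x y \<Longrightarrow> lattice_adj x y" "v \<in> cube a b"
  shows "\<exists>y\<in>cube (a - 1) (b + 1) - cube a b. R\<^sup>*\<^sup>* v (y :: int ^ 'd::finite)"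
proof -
  obtain w where w: "R\<^sup>*\<^sup>* v w" "w \<notin> cube a b"
    using assms(1) finite_subset[OF _ finite_cube[of a b]] by blast
  have "(\<exists>y\<in>cube (a - 1) (b + 1) - cube a b. R\<^sup>*\<^sup>* v y) \<or> w \<in> cube a b"
    using w(1)
  proof induction
    case base
    then show ?case using assms(3) by simp
  next
    case (step y z)
    show ?case
    proof (cases "y \<in> cube a b \<and> z \<notin> cube a b")
      case True
      have "z \<in> cube (a - 1) (b + 1)"
        unfolding cube_def
      proof (intro CollectI allI)
        fix i
        have "\<bar>y $ i - z $ i\<bar> \<le> 1" using assms(2)[OF step.hyps(2)] by (rule lattice_adj_coord)
        moreover have "a \<le> y $ i" "y $ i < b" using True by (auto simp: cube_def)
        ultimately show "a - 1 \<le> z $ i \<and> z $ i < b + 1" by linarith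
      qed
      then show ?thesis using True step.hyps by (intro disjI1 bexI[of _ z]) auto
    qed (use step in auto)
  qed
  then show ?thesis using w(2) by blast
qed

text \<open>The n^d tiles lie in a cube of side 2 L n. Every branch of a trifurcation tile is
  infinite and reaches the layer of width one around this cube, so
  \<open>trifurcation_representatives\<close> applies with the layer as \<open>Y\<close>; the
  difference of powers is the size of the layer.\<close>

lemma card_trifurcations_le:
  fixes \<omega> :: "'d::finite config"
  assumes L: "L \<ge> 1" and "\<omega> \<in> space config_space"
  shows "card {z \<in> cube 0 (int n). trifurcation (tile L z) \<omega>}
    \<le> nat (2 * L * int n + 2) ^ CARD('d) - nat (2 * L * int n) ^ CARD('d)"
proof -
  define Z where "Z = {z \<in> cube 0 (int n). trifurcation (tile L z) \<omega>}"
  define T where "T = tile L ` Z"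
  define A where "A = (cube (- L) (2 * L * int n - L) :: (int ^ 'd) set)"
  define B where "B = (cube (- L - 1) (2 * L * int n - L + 1) :: (int ^ 'd) set)"
  have finZ: "finite Z" by (simp add: Z_def finite_cube)
  have ne: "tile L z \<noteq> {}" for z :: "int ^ 'd"
  proof -
    have "(\<chi> i. 2 * L * z $ i) \<in> tile L z" using L by (auto simp: in_tile_iff)
    then show ?thesis by blast
  qed
  have inj: "inj_on (tile L) Z"
    by (rule inj_onI) (metis L ne disjoint_tiles Int_absorb)
  have "\<exists>Y'\<subseteq>B - A. finite Y' \<and> card Y' = card T \<and> pairwise (\<lambda>x y. \<not> (sever T (open_adj \<omega>))\<^sup>*\<^sup>* x y) Y'"
  proof (rule trifurcation_representatives[OF symp_open_adj])
    show "finite T" using finZ by (simp add: T_def)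
    show "pairwise disjnt T"
    proof (rule pairwiseI)
      fix P Q assume "P \<in> T" "Q \<in> T" "P \<noteq> Q"
      then obtain z w where "P = tile L z" "Q = tile L w" "z \<noteq> w" by (auto simp: T_def)
      then show "disjnt P Q" using disjoint_tiles[OF L, of z w] by (simp add: disjnt_def)
    qed
  next
    fix Q x y assume Q: "Q \<in> T" "x \<in> Q" "y \<in> Q"
    then obtain z where "Q = tile L z" "\<omega> \<in> all_open (box_edges Q)" by (auto simp: T_def Z_def trifurcation_def)
    then show "(\<lambda>x y. open_adj \<omega> x y \<and> x \<in> Q \<and> y \<in> Q)\<^sup>*\<^sup>* x y"
      using Q tile_connected by (intro cube_open_connected) auto
  next
    fix Q assume "Q \<in> T"
    then obtain z where z: "z \<in> cube 0 (int n)" "Q = tile L z" "trifurcation Q \<omega>" by (auto simp: T_def Z_def)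
    then obtain V where V: "V \<subseteq> Q" "card V = 3" "separated (sever {Q} (open_adj \<omega>)) V"
      by (auto simp: trifurcation_def)
    have "\<exists>y\<in>B - A. (sever {Q} (open_adj \<omega>))\<^sup>*\<^sup>* v y" if "v \<in> V" for v
      unfolding A_def B_def
    proof (rule infinite_cluster_leaves_cube)
      show "infinite {y. (sever {Q} (open_adj \<omega>))\<^sup>*\<^sup>* v y}" using V(3) that by (auto simp: separated_def)
      show "v \<in> cube (- L) (2 * L * int n - L)" using that V(1) z(2) tile_subset_cube[OF L z(1)] by auto
    qed (auto simp: sever_def open_adj_def)
    then show "\<exists>V\<subseteq>Q. card V = 3 \<and> pairwise (\<lambda>x y. \<not> (sever {Q} (open_adj \<omega>))\<^sup>*\<^sup>* x y) V \<and>
        (\<forall>v\<in>V. \<exists>y\<in>B - A. (sever {Q} (open_adj \<omega>))\<^sup>*\<^sup>* v y)"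
      using V by (auto simp: separated_def)
  qed
  then obtain Y' where Y': "Y' \<subseteq> B - A" "card Y' = card T" by blast
  have "finite (B - A)" unfolding B_def by (intro finite_Diff finite_cube)
  then have "card T \<le> card (B - A)" using Y' by (metis card_mono)
  also have "\<dots> = card B - card A"
    by (rule card_Diff_subset) (auto simp: A_def B_def finite_cube, auto simp: cube_def, (smt (verit))+)
  also have "card B = nat (2 * L * int n + 2) ^ CARD('d)" by (simp add: B_def card_cube)
  also have "card A = nat (2 * L * int n) ^ CARD('d)" by (simp add: A_def card_cube)
  finally show ?thesis using inj by (simp add: T_def card_image flip: Z_def)
qed

lemma box_edges_translate: "box_edges ((+) v ` Q) = (`) ((+) v) ` box_edges Q"
proof (intro equalityI subsetI)
  fix e assume e: "e \<in> box_edges ((+) v ` Q)"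
  have "e = (+) v ` ((+) (- v) ` e)" by (auto simp: image_image)
  moreover have "(+) (- v) ` e \<in> lattice_edges"
    using e by (simp only: lattice_edges_translate box_edges_def mem_Collect_eq)
  then have "(+) (- v) ` e \<in> box_edges Q" using e by (auto simp: box_edges_def)
  ultimately show "e \<in> (`) ((+) v) ` box_edges Q" by (rule image_eqI)
qed (auto simp: box_edges_def)

lemma trifurcation_translate:
  assumes "\<omega> \<in> space config_space"
  shows "trifurcation ((+) v ` Q) \<omega> \<longleftrightarrow> trifurcation Q (translate v \<omega>)"
proof -
  have "translate v \<omega> \<in> all_open (box_edges Q) \<longleftrightarrow> \<omega> \<in> all_open (box_edges ((+) v ` Q))"
    using vimage_translate_all_open[OF box_edges_subset, of v Q] assms by (auto simp: box_edges_translate)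
  moreover have tr: "sever {Q} (open_adj (translate v \<omega>)) a b \<longleftrightarrow> sever {(+) v ` Q} (open_adj \<omega>) (v + a) (v + b)" for a b
    by (auto simp: sever_def open_adj_translate)
  have "(\<exists>V\<subseteq>Q. card V = 3 \<and> separated (sever {Q} (open_adj (translate v \<omega>))) V) \<longleftrightarrow>
      (\<exists>V\<subseteq>Q. card ((+) v ` V) = 3 \<and> separated (sever {(+) v ` Q} (open_adj \<omega>)) ((+) v ` V))"
    using separated_translate[of "sever {Q} (open_adj (translate v \<omega>))" "sever {(+) v ` Q} (open_adj \<omega>)" v, OF tr]
    by (simp add: card_image)
  moreover have "\<dots> \<longleftrightarrow> (\<exists>V\<subseteq>(+) v ` Q. card V = 3 \<and> separated (sever {(+) v ` Q} (open_adj \<omega>)) V)"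
    by (auto simp: subset_image_iff)
  ultimately show ?thesis by (simp add: trifurcation_def)
qed

lemma sets_three_branches:
  assumes "finite Q"
  shows "{\<omega> \<in> space config_space. \<exists>V\<subseteq>Q. card V = 3 \<and> separated (sever {Q} (open_adj \<omega>)) V} \<in> sets config_space"
proof -
  have eq: "{\<omega> \<in> space config_space. \<exists>V\<subseteq>Q. card V = 3 \<and> separated (sever {Q} (open_adj \<omega>)) V} =
      (\<Union>V\<in>{V \<in> Pow Q. card V = 3}. {\<omega> \<in> space config_space. separated (sever {Q} (open_adj \<omega>)) V})"
    by auto
  show ?thesis unfolding eq
    using assms by (intro sets.finite_UN predE[OF pred_separated] pred_sever pred_open_adj) (auto intro: finite_subset)
qed

lemma sets_trifurcation:
  assumes "finite Q"
  shows "{\<omega> \<in> space config_space. trifurcation Q \<omega>} \<in> sets config_space"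
proof -
  have "{\<omega> \<in> space config_space. trifurcation Q \<omega>} = all_open (box_edges Q) \<inter>
      {\<omega> \<in> space config_space. \<exists>V\<subseteq>Q. card V = 3 \<and> separated (sever {Q} (open_adj \<omega>)) V}"
    by (auto simp: trifurcation_def all_open_def)
  then show ?thesis
    using sets_three_branches[OF assms] sets_all_open[OF finite_box_edges[OF assms] box_edges_subset] by simp
qed

text \<open>By translation invariance every tile is a trifurcation with the same probability c.
  Among n^d tiles the expected number is n^d c, but the number itself is at most the size of a
  shell, of order n^(d-1).\<close>

lemma prob_trifurcation_0:
  assumes p: "0 \<le> p" "p \<le> 1" and L: "L \<ge> 1"
  shows "measure (bond_percolation p) {\<omega> \<in> space config_space. trifurcation (cube (- L) L :: (int ^ 'd::finite) set) \<omega>} = 0"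
proof -
  let ?M = "bond_percolation p :: 'd config measure"
  interpret prob_space ?M by (rule prob_space_bond_percolation)
  define E where "E z = {\<omega> \<in> space config_space. trifurcation (tile L z) \<omega>}" for z :: "int ^ 'd"
  have fin: "finite (tile L z)" for z :: "int ^ 'd" by (simp add: tile_def finite_cube)
  have E [measurable]: "E z \<in> events" for z
    using sets_trifurcation[OF fin[of z]] by (simp add: E_def sets_bond_percolation)
  define c where "c = prob (E 0)"
  have Ec: "prob (E z) = c" for z
  proof -
    have "E z = translate (\<chi> i. 2 * L * z $ i) -` E 0 \<inter> space config_space"
      using trifurcation_translate[of _ "\<chi> i. 2 * L * z $ i" "cube (- L) L"] measurable_space[OF measurable_translate]
      by (auto simp: E_def tile_0 tile_def[of L z])
    then show ?thesis
      using emeasure_vimage_translate[OF p, of "E 0"] E[of 0]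
      by (simp add: c_def measure_def sets_bond_percolation)
  qed
  let ?d = "CARD('d)"
  have bound: "real n ^ ?d * c \<le> (2 * real_of_int L * real n + 2) ^ ?d - (2 * real_of_int L * real n) ^ ?d" for n
  proof -
    let ?K = "(2 * real_of_int L * real n + 2) ^ ?d - (2 * real_of_int L * real n) ^ ?d"
    let ?C = "cube 0 (int n) :: (int ^ 'd) set"
    have count: "(\<Sum>z\<in>?C. indicat_real (E z) \<omega>) \<le> ?K" if "\<omega> \<in> space ?M" for \<omega>
    proof -
      have "(\<Sum>z\<in>?C. indicat_real (E z) \<omega>) = (\<Sum>z\<in>?C. if trifurcation (tile L z) \<omega> then 1 else 0)"
        using that by (intro sum.cong) (auto simp: E_def indicator_def space_bond_percolation)
      also have "\<dots> = (\<Sum>z\<in>{z \<in> ?C. trifurcation (tile L z) \<omega>}. 1)"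
        by (rule sum.inter_filter[symmetric, OF finite_cube])
      also have "\<dots> = real (card {z \<in> ?C. trifurcation (tile L z) \<omega>})" by simp
      also have "\<dots> \<le> real (nat (2 * L * int n + 2) ^ ?d - nat (2 * L * int n) ^ ?d)"
        using card_trifurcations_le[OF L, of \<omega> n] that unfolding space_bond_percolation by (simp only: of_nat_le_iff)
      also have "\<dots> = ?K"
      proof -
        have "0 \<le> 2 * L * int n" using L by simp
        then have "nat (2 * L * int n) ^ ?d \<le> nat (2 * L * int n + 2) ^ ?d" by (intro power_mono) auto
        then show ?thesis using \<open>0 \<le> 2 * L * int n\<close> by (simp add: of_nat_diff)
      qed
      finally show ?thesis .
    qed
    have "real n ^ ?d * c = (\<Sum>z\<in>?C. prob (E z))" by (simp add: Ec card_cube)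
    also have "\<dots> = expectation (\<lambda>\<omega>. \<Sum>z\<in>?C. indicat_real (E z) \<omega>)" by (simp add: emeasure_eq_measure)
    also have "\<dots> \<le> expectation (\<lambda>\<omega>. ?K)"
      by (intro integral_mono_AE AE_I2 count) (auto simp: emeasure_eq_measure)
    finally show ?thesis by (simp add: prob_space)
  qed
  \<comment> \<open>After division by n^d the bound is a difference of d-th powers that tends to 0;
    \<open>Suc n\<close> avoids division by 0.\<close>
  have "c \<le> (2 * real_of_int L + 2 / real (Suc n)) ^ ?d - (2 * real_of_int L) ^ ?d" for n
  proof -
    let ?n = "real (Suc n)"
    have "?n ^ ?d * c \<le> (?n * (2 * real_of_int L + 2 / ?n)) ^ ?d - (?n * (2 * real_of_int L)) ^ ?d"
      using bound[of "Suc n"] by (simp add: distrib_left mult.commute mult.left_commute del: of_nat_Suc)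
    also have "\<dots> = ?n ^ ?d * ((2 * real_of_int L + 2 / ?n) ^ ?d - (2 * real_of_int L) ^ ?d)"
      by (simp only: power_mult_distrib right_diff_distrib)
    finally show ?thesis by (subst (asm) mult_le_cancel_left_pos) auto
  qed
  moreover have "(\<lambda>n. (2 * real_of_int L + 2 / real (Suc n)) ^ ?d - (2 * real_of_int L) ^ ?d) \<longlonglongrightarrow>
      (2 * real_of_int L + 2 * 0) ^ ?d - (2 * real_of_int L) ^ ?d"
    unfolding divide_inverse by (intro tendsto_intros LIMSEQ_inverse_real_of_nat)
  ultimately have "c \<le> 0" by (intro LIMSEQ_le_const) auto
  then have "c = 0" unfolding c_def by (rule antisym) (rule measure_nonneg)
  then show ?thesis by (simp add: c_def E_def tile_0)
qed

section \<open>At most one infinite cluster\<close>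

lemma vimage_open_up_null:
  assumes p: "0 < p" "p \<le> 1" and J: "finite J" "J \<subseteq> lattice_edges" and A: "A \<in> sets config_space"
    and "measure (bond_percolation p) (all_open J \<inter> A) = 0"
  shows "AE \<omega> in bond_percolation p. open_up J \<omega> \<notin> A"
proof -
  let ?M = "bond_percolation p"
  interpret prob_space ?M by (rule prob_space_bond_percolation)
  have "ennreal (p ^ card J) * emeasure ?M (open_up J -` A \<inter> space config_space) = 0"
    using emeasure_Int_all_open[OF _ _ J A, of p] p assms(6) by (simp add: emeasure_eq_measure)
  \<comment> \<open>The factor \<open>p ^ card J\<close> is positive since 0 < p, so the preimage
    under \<open>open_up J\<close> is itself null.\<close>
  then have "emeasure ?M (open_up J -` A \<inter> space config_space) = 0" using p by simp
  moreover have "open_up J -` A \<inter> space config_space \<in> sets ?M"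
    using measurable_sets[OF measurable_open_up A] by (simp add: sets_bond_percolation)
  ultimately show ?thesis
    by (intro AE_I[of _ _ "open_up J -` A \<inter> space config_space"]) (auto simp: space_bond_percolation)
qed

text \<open>Otherwise some fixed \<open>V\<close> of three vertices is separated with positive
  probability. Severing a cube around \<open>V\<close> leaves three infinite branches; they persist
  when the edges of the cube are opened, and the cube becomes a trifurcation, which has probability
  0.\<close>

lemma AE_not_three_clusters:
  assumes p: "0 < p" "p \<le> 1"
  shows "AE \<omega> in bond_percolation p. \<not> many_clusters 3 (open_adj (\<omega> :: 'd::finite config))"
proof (rule ccontr)
  let ?M = "bond_percolation p :: 'd config measure"
  interpret prob_space ?M by (rule prob_space_bond_percolation)
  assume "\<not> ?thesis"
  then obtain V where V: "finite V" "card V = 3" "\<not> (AE \<omega> in ?M. \<not> separated (open_adj \<omega>) V)"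
    using not_AE_many_clustersD[where p = p and k = 3 and P = "\<lambda>_. True"] by auto
  obtain L where L: "L \<ge> 1" "V \<subseteq> cube (- L) L" using finite_subset_cube[OF V(1)] by blast
  let ?Q = "cube (- L) L :: (int ^ 'd) set"
  let ?A = "{\<omega> \<in> space config_space. \<exists>V\<subseteq>?Q. card V = 3 \<and> separated (sever {?Q} (open_adj \<omega>)) V}"
  have "all_open (box_edges ?Q) \<inter> ?A = {\<omega> \<in> space config_space. trifurcation ?Q \<omega>}"
    by (auto simp: trifurcation_def all_open_def)
  then have "prob (all_open (box_edges ?Q) \<inter> ?A) = 0" using prob_trifurcation_0[OF _ p(2) L(1)] p by simp
  then have "AE \<omega> in ?M. open_up (box_edges ?Q) \<omega> \<notin> ?A"
    by (intro vimage_open_up_null[OF p finite_box_edges[OF finite_cube] box_edges_subset sets_three_branches[OF finite_cube]])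
  then have "AE \<omega> in ?M. \<not> separated (open_adj \<omega>) V"
  proof (eventually_elim)
    case (elim \<omega>)
    have "open_up (box_edges ?Q) \<omega> \<in> space config_space" by (simp add: space_config_space open_up_def)
    then have "\<not> (\<exists>V\<subseteq>?Q. card V = 3 \<and> separated (sever {?Q} (open_adj \<omega>)) V)"
      using elim by (simp add: sever_open_up)
    then show ?case using separated_sever[OF symp_open_adj _ L(2) finite_cube, of \<omega>] V(2) by auto
  qed
  then show False using V(3) by simp
qed

text \<open>By the zero-one law two clusters would be present almost surely, hence by
  \<open>vimage_open_up_null\<close> also almost surely after the edges of a cube have been opened.
  But if the cube contains representatives of two clusters and there is no third, opening it leaves
  at most one.\<close>

lemma AE_not_two_clusters:
  assumes p: "0 < p" "p \<le> 1"
  shows "AE \<omega> in bond_percolation p. \<not> many_clusters 2 (open_adj (\<omega> :: 'd::finite config))"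
proof (rule ccontr)
  let ?M = "bond_percolation p :: 'd config measure"
  interpret prob_space ?M by (rule prob_space_bond_percolation)
  assume not: "\<not> ?thesis"
  then have two: "AE \<omega> in ?M. many_clusters 2 (open_adj \<omega>)"
    using many_clusters_zero_one[of p 2] p by auto
  have "\<not> (AE \<omega> in ?M. \<not> (many_clusters 2 (open_adj \<omega>) \<and> \<not> many_clusters 3 (open_adj \<omega>)))"
  proof
    assume "AE \<omega> in ?M. \<not> (many_clusters 2 (open_adj \<omega>) \<and> \<not> many_clusters 3 (open_adj \<omega>))"
    with AE_not_three_clusters[OF p] have "AE \<omega> in ?M. \<not> many_clusters 2 (open_adj \<omega>)"
      by eventually_elim auto
    then show False using not by simp
  qed
  from not_AE_many_clustersD[OF this] obtain V where V: "finite V" "card V = 2"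
    "\<not> (AE \<omega> in ?M. \<not> (separated (open_adj \<omega>) V \<and> \<not> many_clusters 3 (open_adj \<omega>)))" by auto
  obtain L where L: "L \<ge> 1" "V \<subseteq> cube (- L) L" using finite_subset_cube[OF V(1)] by blast
  let ?Q = "cube (- L) L :: (int ^ 'd) set"
  let ?A = "{\<omega> :: 'd config \<in> space config_space. \<not> many_clusters 2 (open_adj \<omega>)}"
  have A: "?A \<in> sets config_space"
    by (rule predE) (intro pred_intros_logic pred_many_clusters pred_open_adj)
  have "AE \<omega> in ?M. \<omega> \<notin> all_open (box_edges ?Q) \<inter> ?A" using two by eventually_elim auto
  moreover have "all_open (box_edges ?Q) \<inter> ?A \<in> events"
    using sets.Int[OF sets_all_open[OF finite_box_edges[OF finite_cube] box_edges_subset] A]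
    by (simp only: sets_bond_percolation)
  ultimately have "prob (all_open (box_edges ?Q) \<inter> ?A) = 0" using prob_eq_0 by blast
  then have "AE \<omega> in ?M. open_up (box_edges ?Q) \<omega> \<notin> ?A"
    by (intro vimage_open_up_null[OF p finite_box_edges[OF finite_cube] box_edges_subset A])
  then have "AE \<omega> in ?M. \<not> (separated (open_adj \<omega>) V \<and> \<not> many_clusters 3 (open_adj \<omega>))"
  proof (eventually_elim)
    case (elim \<omega>)
    let ?R' = "open_adj (open_up (box_edges ?Q) \<omega>)"
    have "open_up (box_edges ?Q) \<omega> \<in> space config_space" by (simp add: space_config_space open_up_def)
    then have two': "many_clusters 2 ?R'" using elim by simp
    show ?case
    proof
      assume sep: "separated (open_adj \<omega>) V \<and> \<not> many_clusters 3 (open_adj \<omega>)"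
      have "\<not> many_clusters 2 ?R'"
      proof (rule not_many_clusters_merge)
        show "?R'\<^sup>*\<^sup>* x y" if "x \<in> ?Q" "y \<in> ?Q" for x y
          using cube_open_connected[OF open_up_in_all_open[OF box_edges_subset] cube_connected that]
          by (rule mono_rtranclp[rule_format, rotated]) auto
        show "\<not> many_clusters (Suc (card V)) (open_adj \<omega>)" using sep V(2) by (simp add: numeral_3_eq_3)
        show "sever {?Q} ?R' = sever {?Q} (open_adj \<omega>)" by (rule sever_open_up)
      qed (use sep V L symp_open_adj in \<open>auto simp: open_adj_open_up\<close>)
      then show False using two' by simp
    qed
  qed
  then show False using V(3) by simp
qed

section \<open>The growth rate on the infinite cluster\<close>

abbreviation path_growth :: "'d::finite config \<Rightarrow> int ^ 'd \<Rightarrow> ereal" where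
  "path_growth \<omega> x \<equiv> growth (\<lambda>N. num_open_paths \<omega> N x)"

definition path_edges :: "'a list \<Rightarrow> 'a set set" where
  "path_edges S = (\<lambda>n. {S ! n, S ! Suc n}) ` {n. Suc n < length S}"

lemma finite_path_edges: "finite (path_edges S)"
proof -
  have "{n. Suc n < length S} \<subseteq> {..length S}" by auto
  then show ?thesis unfolding path_edges_def using finite_subset by blast
qed

text \<open>Self-avoidance makes the edges of a path pairwise different, so that a path of length N
  survives thinning with probability exactly q^N.\<close>

lemma card_path_edges:
  assumes "distinct S" "length S = Suc N"
  shows "card (path_edges S) = N"
proof -
  have "inj_on (\<lambda>n. {S ! n, S ! Suc n}) {n. Suc n < length S}"
    by (rule inj_onI) (use assms(1) in \<open>auto simp: doubleton_eq_iff nth_eq_iff_index_eq\<close>)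
  moreover have "{n. Suc n < length S} = {..<N}" using assms(2) by auto
  ultimately show ?thesis by (simp add: path_edges_def card_image)
qed

lemma lattice_edgesI: "lattice_adj x y \<Longrightarrow> {x, y} \<in> lattice_edges"
  by (auto simp: lattice_edges_def)

lemma path_edges_subset: "S \<in> self_avoiding_paths N x \<Longrightarrow> path_edges S \<subseteq> lattice_edges"
  by (auto simp: self_avoiding_paths_def path_edges_def lattice_edges_def)

lemma open_path_iff: "open_path \<omega> S \<longleftrightarrow> (\<forall>e\<in>path_edges S. \<omega> e)"
  by (auto simp: open_path_def path_edges_def)

lemma finite_self_avoiding_paths: "finite (self_avoiding_paths N x)"
  unfolding self_avoiding_paths_eq_saw by (rule finite_saw[OF finite_lattice_adj])

lemma num_open_paths_eq_sum:
  assumes "\<omega> \<in> space config_space"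
  shows "real (num_open_paths \<omega> N x) = (\<Sum>S\<in>self_avoiding_paths N x. indicator (all_open (path_edges S)) \<omega>)"
proof -
  have "(\<Sum>S\<in>self_avoiding_paths N x. indicator (all_open (path_edges S)) \<omega>) =
      (\<Sum>S\<in>self_avoiding_paths N x. if open_path \<omega> S then 1 else (0 :: real))"
    using assms by (intro sum.cong) (auto simp: all_open_def open_path_iff indicator_def)
  also have "\<dots> = (\<Sum>S\<in>{S \<in> self_avoiding_paths N x. open_path \<omega> S}. 1)"
    by (rule sum.inter_filter[symmetric, OF finite_self_avoiding_paths])
  finally show ?thesis by (simp add: num_open_paths_def)
qed

lemma measurable_num_open_paths:
  "(\<lambda>\<omega>. real (num_open_paths \<omega> N x)) \<in> borel_measurable config_space"
proof -
  have "(\<lambda>\<omega>. \<Sum>S\<in>self_avoiding_paths N x. indicat_real (all_open (path_edges S)) \<omega>) \<in> borel_measurable config_space"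
    by (intro borel_measurable_sum borel_measurable_indicator sets_all_open finite_path_edges path_edges_subset)
  then show ?thesis by (rule measurable_cong[THEN iffD1, rotated]) (simp add: num_open_paths_eq_sum)
qed

lemma measurable_path_growth: "(\<lambda>\<omega>. path_growth \<omega> x) \<in> borel_measurable config_space"
proof -
  have "(\<lambda>\<omega>. root N (real (num_open_paths \<omega> N x))) \<in> borel_measurable config_space" for N
    by (rule measurable_compose[OF measurable_num_open_paths])
       (intro borel_measurable_continuous_onI continuous_on_real_root continuous_on_id)
  then show ?thesis unfolding growth_def by measurable
qed

lemma path_growth_translate: "path_growth (translate v \<omega>) x = path_growth \<omega> (v + x)"
  unfolding num_open_paths_eq
  using card_saw_bij[of "(+) v" "open_adj \<omega>" "open_adj (translate v \<omega>)"]
  by (simp add: open_adj_translate bij_plus)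

text \<open>Provides the finiteness that makes the constant a real number, and the bound at p = 1
  from which the bound at smaller p is derived.\<close>

lemma path_growth_le: "path_growth \<omega> (x :: int ^ 'd::finite) \<le> ereal (connective_constant TYPE('d))"
proof -
  have "path_growth \<omega> x \<le> growth (\<lambda>N. card (saw lattice_adj N x))"
    unfolding num_open_paths_eq
    by (intro growth_mono card_mono finite_saw[OF finite_lattice_adj] saw_mono) (simp add: open_adj_def)
  then show ?thesis by (simp only: growth_lattice)
qed

lemma infinite_open_cluster_iff: "x \<in> infinite_open_cluster \<omega> \<longleftrightarrow> infinite {y. (open_adj \<omega>)\<^sup>*\<^sup>* x y}"
  by (simp add: infinite_open_cluster_def open_cluster_def)

lemma many_clusters_1_iff: "many_clusters 1 (open_adj \<omega>) \<longleftrightarrow> infinite_open_cluster \<omega> \<noteq> {}"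
proof
  assume "many_clusters 1 (open_adj \<omega>)"
  then obtain V where "card V = 1" "separated (open_adj \<omega>) V" by (auto simp: many_clusters_def)
  then show "infinite_open_cluster \<omega> \<noteq> {}"
    by (auto simp: card_1_singleton_iff separated_def infinite_open_cluster_iff)
next
  assume "infinite_open_cluster \<omega> \<noteq> {}"
  then obtain x where "x \<in> infinite_open_cluster \<omega>" by auto
  then have "separated (open_adj \<omega>) {x}" by (simp add: separated_def infinite_open_cluster_iff)
  then show "many_clusters 1 (open_adj \<omega>)" unfolding many_clusters_def by (intro exI[of _ "{x}"]) simp
qed

lemma AE_path_growth_const:
  assumes p: "0 < p" "p \<le> 1"
  shows "\<exists>c. AE \<omega> in (bond_percolation p :: 'd::finite config measure).
    \<forall>x\<in>infinite_open_cluster \<omega>. path_growth \<omega> x = c"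
proof -
  \<comment> \<open>A supremum over all lattice vertices is a countable one, hence measurable, and
    it is translation invariant. The default 0 off infinite clusters does not raise it, since growth
    rates are nonnegative.\<close>
  define G :: "'d config \<Rightarrow> ereal" where
    "G \<omega> = (SUP x. if infinite {y. (open_adj \<omega>)\<^sup>*\<^sup>* x y} then path_growth \<omega> x else 0)" for \<omega>
  have "\<exists>c. AE \<omega> in bond_percolation p. G \<omega> = c"
  proof (rule invariant_AE_const)
    have [measurable]: "Measurable.pred config_space (\<lambda>\<omega>. infinite {y. (open_adj \<omega>)\<^sup>*\<^sup>* x y})" for x :: "int ^ 'd"
      by (rule pred_infinite_rtranclp[OF pred_open_adj])
    note [measurable] = measurable_path_growth
    have "(\<lambda>\<omega>. if infinite {y. (open_adj \<omega>)\<^sup>*\<^sup>* x y} then path_growth \<omega> x else 0) \<in> borel_measurable config_space" for x :: "int ^ 'd"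
      by (intro measurable_If measurable_path_growth borel_measurable_const) measurable
    then show "G \<in> borel_measurable config_space"
      unfolding G_def[abs_def] by (intro borel_measurable_SUP) auto
    fix v :: "int ^ 'd" and \<omega> :: "'d config"
    have "G (translate v \<omega>) = (SUP x. if infinite {y. (open_adj \<omega>)\<^sup>*\<^sup>* (v + x) y} then path_growth \<omega> (v + x) else 0)"
      unfolding G_def path_growth_translate
      using infinite_rtranclp_translate[of "open_adj (translate v \<omega>)" "open_adj \<omega>" v, OF open_adj_translate] by simp
    also have "\<dots> = (SUP x\<in>range ((+) v). if infinite {y. (open_adj \<omega>)\<^sup>*\<^sup>* x y} then path_growth \<omega> x else 0)"
      by (simp only: image_image)
    also have "range ((+) v) = UNIV" by (rule bij_is_surj) (rule bij_plus)
    finally show "G (translate v \<omega>) = G \<omega>" by (simp add: G_def)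
  qed (use p in auto)
  then obtain c where c: "AE \<omega> in bond_percolation p. G \<omega> = c" by auto
  with AE_not_two_clusters[OF p] have "AE \<omega> in (bond_percolation p :: 'd config measure).
    \<forall>x\<in>infinite_open_cluster \<omega>. path_growth \<omega> x = c"
  proof eventually_elim
    case (elim \<omega>)
    show ?case
    proof
      fix x assume x: "x \<in> infinite_open_cluster \<omega>"
      have same: "path_growth \<omega> y = path_growth \<omega> x" if y: "infinite {z. (open_adj \<omega>)\<^sup>*\<^sup>* y z}" for y
      proof (cases "(open_adj \<omega>)\<^sup>*\<^sup>* x y")
        case True
        then show ?thesis unfolding num_open_paths_eq
          by (rule growth_saw_connected[OF finite_open_adj symp_open_adj, symmetric])
      next
        case False
        then have "\<not> (open_adj \<omega>)\<^sup>*\<^sup>* y x" using rtranclp_commute[OF symp_open_adj] by blast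
        then have "separated (open_adj \<omega>) {x, y}" "x \<noteq> y"
          using False x y by (auto simp: separated_def pairwise_def infinite_open_cluster_iff)
        then have "many_clusters 2 (open_adj \<omega>)"
          unfolding many_clusters_def by (intro exI[of _ "{x, y}"]) simp
        then show ?thesis using elim by simp
      qed
      have "G \<omega> = path_growth \<omega> x"
        unfolding G_def
      proof (rule antisym)
        show "(SUP x. if infinite {y. (open_adj \<omega>)\<^sup>*\<^sup>* x y} then path_growth \<omega> x else 0) \<le> path_growth \<omega> x"
          by (rule SUP_least) (auto simp: same growth_nonneg)
        show "path_growth \<omega> x \<le> (SUP x. if infinite {y. (open_adj \<omega>)\<^sup>*\<^sup>* x y} then path_growth \<omega> x else 0)"
          by (rule SUP_upper2[of x]) (use x in \<open>auto simp: infinite_open_cluster_iff\<close>)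
      qed
      then show "path_growth \<omega> x = c" using elim by simp
    qed
  qed
  then show ?thesis by auto
qed

subsection \<open>The supercritical range\<close>

text \<open>Shows that the set whose supremum is the threshold contains 0, so the threshold is
  nonnegative and supercritical parameters are positive.\<close>

lemma AE_bond_percolation_0: "AE \<omega> in (bond_percolation 0 :: 'd::finite config measure). infinite_open_cluster \<omega> = {}"
proof -
  let ?M = "bond_percolation 0 :: 'd config measure"
  interpret prob_space ?M by (rule prob_space_bond_percolation)
  have "(lattice_edges :: (int ^ 'd) set set) \<subseteq> (\<lambda>(x, y). {x, y}) ` UNIV" by (auto simp: lattice_edges_def)
  then have "countable (lattice_edges :: (int ^ 'd) set set)" by (rule countable_subset) simp
  moreover have "AE \<omega> in ?M. \<not> \<omega> e" if e: "e \<in> lattice_edges" for e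
  proof -
    have "prob (all_open {e}) = 0" using prob_all_open[of 0 "{e}"] e by simp
    moreover have "all_open {e} \<in> events" using e sets_all_open[of "{e}"] by (simp add: sets_bond_percolation)
    ultimately have "AE \<omega> in ?M. \<omega> \<notin> all_open {e}" using prob_eq_0 by blast
    then show ?thesis using AE_space by eventually_elim (auto simp: all_open_def space_bond_percolation)
  qed
  ultimately have "AE \<omega> in ?M. \<forall>e\<in>lattice_edges. \<not> \<omega> e" by (subst AE_ball_countable) auto
  then show ?thesis
  proof eventually_elim
    case (elim \<omega>)
    then have no: "\<not> open_adj \<omega> x y" for x y by (auto simp: open_adj_def lattice_edges_def)
    have "y = x" if "(open_adj \<omega>)\<^sup>*\<^sup>* x y" for x y
      using that by (rule rtranclp.cases) (use no in auto)
    then have "{y. (open_adj \<omega>)\<^sup>*\<^sup>* x y} \<subseteq> {x}" for x by auto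
    then have "finite {y. (open_adj \<omega>)\<^sup>*\<^sup>* x y}" for x by (rule finite_subset) simp
    then show ?case by (auto simp: infinite_open_cluster_iff)
  qed
qed

lemma percolation_threshold_nonneg: "percolation_threshold TYPE('d::finite) \<ge> 0"
  unfolding percolation_threshold_def
  by (rule cSup_upper) (auto intro: AE_bond_percolation_0 bdd_aboveI[of _ 1])

text \<open>Beyond the supremum, absence of an infinite cluster is not almost sure; the zero-one law
  for \<open>many_clusters 1\<close> turns this into almost sure presence.\<close>

lemma AE_infinite_open_cluster:
  assumes "percolation_threshold TYPE('d::finite) < p" "p \<le> 1"
  shows "AE \<omega> in (bond_percolation p :: 'd config measure). infinite_open_cluster \<omega> \<noteq> {}"
proof -
  have p: "0 \<le> p" using assms(1) percolation_threshold_nonneg[where 'd = 'd] by linarith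
  let ?S = "{p \<in> {0..1}. AE \<omega> in (bond_percolation p :: 'd config measure). infinite_open_cluster \<omega> = {}}"
  have "\<not> (AE \<omega> in (bond_percolation p :: 'd config measure). infinite_open_cluster \<omega> = {})"
  proof
    assume "AE \<omega> in (bond_percolation p :: 'd config measure). infinite_open_cluster \<omega> = {}"
    then have "p \<le> Sup ?S" using p assms(2) by (intro cSup_upper) (auto intro: bdd_aboveI[of _ 1])
    then show False using assms(1) by (simp add: percolation_threshold_def)
  qed
  then show ?thesis
    using many_clusters_zero_one[OF p assms(2), of 1, where 'd = 'd] unfolding many_clusters_1_iff by simp
qed

subsection \<open>Thinning a fixed configuration\<close>

text \<open>For fixed \<omega>, the paths counted after thinning are those open in \<omega> whose N
  edges are all open in \<eta>; linearity of the expectation does the rest.\<close>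

lemma expectation_num_open_paths_thin:
  assumes q: "0 \<le> q" "q \<le> 1" and \<omega>: "\<omega> \<in> space config_space"
  shows "(\<integral>\<^sup>+ \<eta>. ennreal (real (num_open_paths (thin \<omega> \<eta>) N x)) \<partial>bond_percolation q)
    = ennreal (q ^ N * real (num_open_paths \<omega> N x))"
proof -
  let ?A = "{S \<in> self_avoiding_paths N x. open_path \<omega> S}"
  interpret prob_space "bond_percolation q" by (rule prob_space_bond_percolation)
  have fin: "finite ?A" by (rule finite_subset[OF _ finite_self_avoiding_paths]) auto
  have thin: "open_path (thin \<omega> \<eta>) S \<longleftrightarrow> open_path \<omega> S \<and> open_path \<eta> S" if "S \<in> self_avoiding_paths N x" for \<eta> S
    using path_edges_subset[OF that] by (auto simp: open_path_iff thin_def)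
  have eq: "ennreal (real (num_open_paths (thin \<omega> \<eta>) N x)) = (\<Sum>S\<in>?A. indicator (all_open (path_edges S)) \<eta>)"
    if "\<eta> \<in> space (bond_percolation q)" for \<eta>
  proof -
    have "(\<Sum>S\<in>?A. indicator (all_open (path_edges S)) \<eta>) = (\<Sum>S\<in>?A. if open_path \<eta> S then 1 else (0 :: ennreal))"
      using that by (intro sum.cong) (auto simp: all_open_def open_path_iff indicator_def space_bond_percolation)
    also have "\<dots> = (\<Sum>S\<in>{S \<in> ?A. open_path \<eta> S}. 1)" by (rule sum.inter_filter[symmetric, OF fin])
    also have "{S \<in> ?A. open_path \<eta> S} = {S \<in> self_avoiding_paths N x. open_path (thin \<omega> \<eta>) S}" using thin by auto
    finally show ?thesis by (simp add: num_open_paths_def ennreal_of_nat_eq_real_of_nat)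
  qed
  have "(\<integral>\<^sup>+ \<eta>. ennreal (real (num_open_paths (thin \<omega> \<eta>) N x)) \<partial>bond_percolation q)
      = (\<integral>\<^sup>+ \<eta>. (\<Sum>S\<in>?A. indicator (all_open (path_edges S)) \<eta>) \<partial>bond_percolation q)"
    by (intro nn_integral_cong eq)
  also have "\<dots> = (\<Sum>S\<in>?A. emeasure (bond_percolation q) (all_open (path_edges S)))"
    using sets_all_open[OF finite_path_edges path_edges_subset, of _ N x]
    by (subst nn_integral_sum) (auto simp: sets_bond_percolation intro!: borel_measurable_indicator)
  also have "\<dots> = (\<Sum>S\<in>?A. ennreal (q ^ N))"
  proof (rule sum.cong)
    fix S assume S: "S \<in> ?A"
    then have "card (path_edges S) = N" by (intro card_path_edges) (auto simp: self_avoiding_paths_def)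
    then show "emeasure (bond_percolation q) (all_open (path_edges S)) = ennreal (q ^ N)"
      using S path_edges_subset[of S N x] emeasure_all_open[OF q finite_path_edges, of S] by simp
  qed simp
  also have "\<dots> = ennreal (q ^ N * real (num_open_paths \<omega> N x))"
    using q by (simp add: num_open_paths_def ennreal_mult ennreal_of_nat_eq_real_of_nat mult.commute)
  finally show ?thesis .
qed

lemma measurable_num_open_paths_thin:
  assumes "\<omega> \<in> space config_space"
  shows "(\<lambda>\<eta>. ennreal (real (num_open_paths (thin \<omega> \<eta>) N x))) \<in> borel_measurable (bond_percolation q)"
proof -
  have "thin \<omega> \<in> measurable config_space config_space"
    unfolding thin_def[abs_def] by (rule measurable_config_spaceI) (intro pred_intros_logic pred_config_space, simp_all)
  from measurable_compose[OF this measurable_num_open_paths]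
  have "(\<lambda>\<eta>. real (num_open_paths (thin \<omega> \<eta>) N x)) \<in> borel_measurable (bond_percolation q)"
    by (simp add: measurable_cong_sets[OF sets_bond_percolation refl])
  then show ?thesis by measurable
qed

lemma AE_thin_bound:
  assumes q: "0 < q" "q \<le> 1" and \<omega>: "\<omega> \<in> space config_space"
    and b: "path_growth \<omega> x = ereal b" "q * b < b'"
  shows "AE \<eta> in bond_percolation q. \<exists>C. \<forall>N. real (num_open_paths (thin \<omega> \<eta>) N x) \<le> C * b' ^ N"
proof -
  let ?M = "bond_percolation q"
  have b0: "b \<ge> 0" using growth_nonneg[of "\<lambda>N. num_open_paths \<omega> N x"] b(1) by simp
  \<comment> \<open>The gap between q b and b' is split at \<open>a\<close>: the lower part gives
    the bound C (a/q)^N on the paths of \<omega>, the upper part the ratio a/b' < 1 of a geometric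
    series.\<close>
  obtain a where a: "q * b < a" "a < b'" using dense[OF b(2)] by blast
  then have a0: "0 < a" using mult_nonneg_nonneg[of q b] b0 q by linarith
  have "path_growth \<omega> x < ereal (a / q)" using a q b(1) by (simp add: field_simps)
  then obtain C where C: "C > 0" "\<And>N. real (num_open_paths \<omega> N x) \<le> C * (a / q) ^ N"
    using growth_less by blast
  define X where "X N \<eta> = ennreal (real (num_open_paths (thin \<omega> \<eta>) N x)) * ennreal (1 / b' ^ N)" for N \<eta>
  have [measurable]: "X N \<in> borel_measurable ?M" for N
    using measurable_num_open_paths_thin[OF \<omega>, of N x q] unfolding X_def[abs_def] by measurable
  have EX: "(\<integral>\<^sup>+ \<eta>. X N \<eta> \<partial>?M) \<le> ennreal (C * (a / b') ^ N)" for N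
  proof -
    have "(\<integral>\<^sup>+ \<eta>. X N \<eta> \<partial>?M) = ennreal (q ^ N * real (num_open_paths \<omega> N x)) * ennreal (1 / b' ^ N)"
      unfolding X_def using measurable_num_open_paths_thin[OF \<omega>, of N x q] q \<omega>
      by (subst nn_integral_multc) (auto simp: expectation_num_open_paths_thin)
    also have "\<dots> = ennreal (q ^ N * real (num_open_paths \<omega> N x) * (1 / b' ^ N))"
      using q a a0 by (intro ennreal_mult[symmetric]) auto
    also have "\<dots> \<le> ennreal (q ^ N * (C * (a / q) ^ N) * (1 / b' ^ N))"
      using q a a0 C by (intro ennreal_leI mult_right_mono mult_left_mono) auto
    also have "q ^ N * (C * (a / q) ^ N) * (1 / b' ^ N) = C * (a / b') ^ N"
      using q by (simp add: power_divide)
    finally show ?thesis .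
  qed
  \<comment> \<open>The sum of the normalised counts \<open>X N\<close> then has finite expectation,
    so it is almost surely finite, and its value bounds every single term.\<close>
  have "summable (\<lambda>N. C * (a / b') ^ N)"
    using a a0 by (intro summable_mult summable_geometric) auto
  have "(\<integral>\<^sup>+ \<eta>. (\<Sum>N. X N \<eta>) \<partial>?M) = (\<Sum>N. \<integral>\<^sup>+ \<eta>. X N \<eta> \<partial>?M)" by (rule nn_integral_suminf) simp
  also have "\<dots> \<le> (\<Sum>N. ennreal (C * (a / b') ^ N))" by (intro suminf_le EX) auto
  also have "\<dots> = ennreal (\<Sum>N. C * (a / b') ^ N)"
    using \<open>summable _\<close> C a a0 by (intro suminf_ennreal2) auto
  finally have "(\<integral>\<^sup>+ \<eta>. (\<Sum>N. X N \<eta>) \<partial>?M) < \<infinity>" by (simp add: le_less_trans)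
  then have "AE \<eta> in ?M. (\<Sum>N. X N \<eta>) \<noteq> \<infinity>" by (intro nn_integral_PInf_AE) auto
  then show ?thesis
  proof eventually_elim
    case (elim \<eta>)
    then obtain K where K: "(\<Sum>N. X N \<eta>) = ennreal K" "K \<ge> 0" by (cases "\<Sum>N. X N \<eta>") auto
    have "real (num_open_paths (thin \<omega> \<eta>) N x) \<le> K * b' ^ N" for N
    proof -
      have "X N \<eta> \<le> ennreal K" using sum_le_suminf[of "\<lambda>N. X N \<eta>" "{N}"] K(1) by simp
      moreover have "X N \<eta> = ennreal (real (num_open_paths (thin \<omega> \<eta>) N x) * (1 / b' ^ N))"
        unfolding X_def using a a0 by (intro ennreal_mult[symmetric]) auto
      ultimately have "ennreal (real (num_open_paths (thin \<omega> \<eta>) N x) * (1 / b' ^ N)) \<le> ennreal K" by simp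
      then have "real (num_open_paths (thin \<omega> \<eta>) N x) * (1 / b' ^ N) \<le> K"
        using K(2) by (simp add: ennreal_le_iff)
      then show ?thesis using a a0 by (simp add: field_simps)
    qed
    then show ?case by auto
  qed
qed

lemma AE_path_growth_thin_le:
  assumes q: "0 < q" "q \<le> 1" and \<omega>: "\<omega> \<in> space config_space" and b: "path_growth \<omega> x = ereal b"
  shows "AE \<eta> in bond_percolation q. path_growth (thin \<omega> \<eta>) x \<le> ereal (q * b)"
proof -
  have b0: "b \<ge> 0" using growth_nonneg[of "\<lambda>N. num_open_paths \<omega> N x"] b(1) by simp
  \<comment> \<open>The tolerances 1/(k+1) replace all b' > q b by countably many, so the
    exceptional set remains null.\<close>
  have "AE \<eta> in bond_percolation q. \<forall>k::nat. \<exists>C. \<forall>N.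
      real (num_open_paths (thin \<omega> \<eta>) N x) \<le> C * (q * b + inverse (real (Suc k))) ^ N"
    unfolding AE_all_countable by (intro allI AE_thin_bound[OF q \<omega> b]) simp
  then show ?thesis
  proof eventually_elim
    case (elim \<eta>)
    show ?case
    proof (rule growth_le)
      show "0 \<le> q * b" using q b0 by simp
      fix b' assume "q * b < b'"
      then obtain k where k: "inverse (real (Suc k)) < b' - q * b" using reals_Archimedean[of "b' - q * b"] by auto
      obtain C where C: "\<And>N. real (num_open_paths (thin \<omega> \<eta>) N x) \<le> C * (q * b + inverse (real (Suc k))) ^ N"
        using elim by blast
      have "C \<ge> 0" using order_trans[OF of_nat_0_le_iff C[of 0]] by simp
      then have "C * (q * b + inverse (real (Suc k))) ^ N \<le> C * b' ^ N" for N
        using k \<open>0 \<le> q * b\<close> by (intro mult_left_mono power_mono) auto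
      then show "\<exists>C. \<forall>N. real (num_open_paths (thin \<omega> \<eta>) N x) \<le> C * b' ^ N" using C order_trans by blast
    qed
  qed
qed

lemma infinite_open_cluster_thin: "infinite_open_cluster (thin \<omega> \<eta>) \<subseteq> infinite_open_cluster \<omega>"
proof
  fix x assume "x \<in> infinite_open_cluster (thin \<omega> \<eta>)"
  moreover have "{y. (open_adj (thin \<omega> \<eta>))\<^sup>*\<^sup>* x y} \<subseteq> {y. (open_adj \<omega>)\<^sup>*\<^sup>* x y}"
    by (intro Collect_mono impI, erule mono_rtranclp[rule_format, rotated])
       (simp add: open_adj_def thin_def lattice_edgesI)
  ultimately show "x \<in> infinite_open_cluster \<omega>"
    unfolding infinite_open_cluster_iff using finite_subset by blast
qed

text \<open>Presence of an infinite cluster is part of the notion: without it every c would qualify,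
  and the constants at two parameters could not be compared.\<close>

definition has_path_growth :: "'d::finite itself \<Rightarrow> real \<Rightarrow> real \<Rightarrow> bool" where
  "has_path_growth _ p c \<longleftrightarrow> (AE \<omega> in (bond_percolation p :: 'd config measure).
     infinite_open_cluster \<omega> \<noteq> {} \<and> (\<forall>x\<in>infinite_open_cluster \<omega>. path_growth \<omega> x = ereal c))"

lemma (in prob_space) AE_imp_ex:
  assumes "AE x in M. P x"
  shows "\<exists>x. P x"
proof (rule ccontr)
  assume no: "\<not> ?thesis"
  from assms have "AE x in M. False" by (rule eventually_mono) (use no in blast)
  then show False by simp
qed

lemma has_path_growth_exists:
  assumes "percolation_threshold TYPE('d::finite) < p" "p \<le> 1"
  shows "\<exists>c\<le>connective_constant TYPE('d). has_path_growth TYPE('d) p c"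
proof -
  let ?M = "bond_percolation p :: 'd config measure"
  interpret prob_space ?M by (rule prob_space_bond_percolation)
  have "0 < p" using assms(1) percolation_threshold_nonneg[where 'd = 'd] by linarith
  from AE_path_growth_const[OF this assms(2)] obtain c where
    "AE \<omega> in ?M. \<forall>x\<in>infinite_open_cluster \<omega>. path_growth \<omega> x = c" by blast
  with AE_infinite_open_cluster[OF assms] have c: "AE \<omega> in ?M. infinite_open_cluster \<omega> \<noteq> {} \<and>
     (\<forall>x\<in>infinite_open_cluster \<omega>. path_growth \<omega> x = c)" by eventually_elim auto
  then have "\<exists>\<omega> :: 'd config. \<exists>x. path_growth \<omega> x = c"
    using AE_False eventually_mono[OF c, of "\<lambda>_. False"] by blast
  then obtain \<omega> :: "'d config" and x where "path_growth \<omega> x = c" by blast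
  then have "0 \<le> c" "c \<le> ereal (connective_constant TYPE('d))"
    using growth_nonneg path_growth_le[of \<omega> x] by auto
  then obtain r where "c = ereal r" "r \<le> connective_constant TYPE('d)" by (cases c) auto
  then show ?thesis using c unfolding has_path_growth_def by auto
qed

lemma has_path_growth_mono:
  assumes "has_path_growth TYPE('d::finite) p c" "has_path_growth TYPE('d) p' c'" "0 < p" "p \<le> p'" "p' \<le> 1"
  shows "c / p \<le> c' / p'"
proof -
  define q where "q = p / p'"
  have q: "0 < q" "q \<le> 1" "p = p' * q" using assms(3-5) by (auto simp: q_def)
  let ?P' = "bond_percolation p' :: 'd config measure" and ?Q = "bond_percolation q :: 'd config measure"
  interpret P': prob_space ?P' by (rule prob_space_bond_percolation)
  interpret Q: prob_space ?Q by (rule prob_space_bond_percolation)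
  interpret pair: pair_prob_space ?P' ?Q ..
  let ?good = "\<lambda>\<omega>. infinite_open_cluster \<omega> \<noteq> {} \<and> (\<forall>x\<in>infinite_open_cluster \<omega>. path_growth \<omega> x = ereal c)"
  have meas: "(\<lambda>x. thin (fst x) (snd x)) \<in> measurable (?P' \<Otimes>\<^sub>M ?Q) config_space"
    using measurable_thin
    by (simp add: measurable_cong_sets[OF sets_pair_measure_cong[OF sets_bond_percolation sets_bond_percolation] refl])
  have "distr (?P' \<Otimes>\<^sub>M ?Q) config_space (\<lambda>x. thin (fst x) (snd x)) = bond_percolation (p' * q)"
    by (rule distr_thin) (use q assms(3-5) in auto)
  then have "AE \<omega> in distr (?P' \<Otimes>\<^sub>M ?Q) config_space (\<lambda>x. thin (fst x) (snd x)). ?good \<omega>"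
    using assms(1) unfolding has_path_growth_def q(3) by (simp only:)
  then have "AE x in ?P' \<Otimes>\<^sub>M ?Q. ?good (thin (fst x) (snd x))" by (rule AE_distrD[OF meas])
  \<comment> \<open>Fubini: from here on \<omega> can be frozen and \<eta> alone is random.\<close>
  then have "AE \<omega> in ?P'. AE \<eta> in ?Q. ?good (thin \<omega> \<eta>)" by (auto dest: pair.AE_pair)
  with assms(2) have "AE \<omega> in ?P'. \<omega> \<in> space config_space \<and> (\<forall>x\<in>infinite_open_cluster \<omega>. path_growth \<omega> x = ereal c') \<and>
      (AE \<eta> in ?Q. ?good (thin \<omega> \<eta>))"
    using AE_space unfolding has_path_growth_def by eventually_elim (auto simp: space_bond_percolation)
  \<comment> \<open>The claim concerns only the constants \<open>c\<close> and \<open>c'\<close>, so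
    a single suitable \<omega> is enough.\<close>
  then have "\<exists>\<omega>. \<omega> \<in> space config_space \<and> (\<forall>x\<in>infinite_open_cluster \<omega>. path_growth \<omega> x = ereal c') \<and>
      (AE \<eta> in ?Q. ?good (thin \<omega> \<eta>))"
    by (rule P'.AE_imp_ex)
  then obtain \<omega> where \<omega>: "\<omega> \<in> space config_space" "\<forall>x\<in>infinite_open_cluster \<omega>. path_growth \<omega> x = ereal c'"
    and good: "AE \<eta> in ?Q. ?good (thin \<omega> \<eta>)" by blast
  \<comment> \<open>The bound is obtained at all vertices simultaneously, since the vertex at which
    the rates are compared depends on \<eta>.\<close>
  have "AE \<eta> in ?Q. \<forall>x\<in>infinite_open_cluster \<omega>. path_growth (thin \<omega> \<eta>) x \<le> ereal (q * c')"
    using AE_path_growth_thin_le[OF q(1,2) \<omega>(1)] \<omega>(2) by (subst AE_ball_countable) auto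
  with good have "AE \<eta> in ?Q. c \<le> q * c'"
  proof eventually_elim
    case (elim \<eta>)
    then obtain x where x: "x \<in> infinite_open_cluster (thin \<omega> \<eta>)" by auto
    then have "x \<in> infinite_open_cluster \<omega>" using infinite_open_cluster_thin by auto
    then have "ereal c \<le> ereal (q * c')" using elim x by metis
    then show ?case by simp
  qed
  then have "c \<le> q * c'" by simp
  then show ?thesis using assms(3-5) by (simp add: q_def field_simps)
qed

theorem proposition1p1:
  assumes "CARD('d::finite) \<ge> 2"
  shows "\<exists>\<mu> :: real \<Rightarrow> real.
    (\<forall>p \<in> {percolation_threshold TYPE('d)<..1}.
       (AE \<omega> in (bond_percolation p :: 'd config measure).
          \<forall>x \<in> infinite_open_cluster \<omega>.
            limsup (\<lambda>N. ereal (root N (real (num_open_paths \<omega> N x)))) = ereal (\<mu> p)) \<and>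
       \<mu> p \<le> p * connective_constant TYPE('d)) \<and>
    mono_on {percolation_threshold TYPE('d)<..1}
      (\<lambda>p. \<mu> p / (p * connective_constant TYPE('d)))"
proof -
  let ?D = "{percolation_threshold TYPE('d)<..1}"
  let ?\<kappa> = "connective_constant TYPE('d)"
  have "\<forall>p\<in>?D. \<exists>c\<le>?\<kappa>. has_path_growth TYPE('d) p c"
    using has_path_growth_exists[where 'd = 'd] by simp
  then obtain \<mu> where \<mu>: "\<And>p. p \<in> ?D \<Longrightarrow> \<mu> p \<le> ?\<kappa>" "\<And>p. p \<in> ?D \<Longrightarrow> has_path_growth TYPE('d) p (\<mu> p)"
    by metis
  have pos: "0 < p" if "p \<in> ?D" for p
    using that percolation_threshold_nonneg[where 'd = 'd] by simp
  have ratio: "\<mu> p / p \<le> \<mu> p' / p'" if "p \<in> ?D" "p' \<in> ?D" "p \<le> p'" for p p'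
    using has_path_growth_mono[OF \<mu>(2)[OF that(1)] \<mu>(2)[OF that(2)] pos[OF that(1)] that(3)] that(2) by simp
  have "AE \<omega> in (bond_percolation p :: 'd config measure). \<forall>x \<in> infinite_open_cluster \<omega>.
      limsup (\<lambda>N. ereal (root N (real (num_open_paths \<omega> N x)))) = ereal (\<mu> p)" if "p \<in> ?D" for p
    using \<mu>(2)[OF that] unfolding has_path_growth_def growth_def by eventually_elim simp
  moreover have "\<mu> p \<le> p * ?\<kappa>" if "p \<in> ?D" for p
  proof -
    \<comment> \<open>Any member of the interval puts the threshold below 1, so the endpoint 1 is
      available, and monotonicity of the ratio up to 1 yields the upper bound.\<close>
    have "1 \<in> ?D" using that by simp
    then have "\<mu> p / p \<le> ?\<kappa>" using ratio[OF that, of 1] \<mu>(1)[of 1] that by simp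
    then show ?thesis using pos[OF that] by (simp add: field_simps)
  qed
  moreover have "mono_on ?D (\<lambda>p. \<mu> p / (p * ?\<kappa>))"
  proof (rule mono_onI)
    fix p p' assume "p \<in> ?D" "p' \<in> ?D" "p \<le> p'"
    then have "\<mu> p / p / ?\<kappa> \<le> \<mu> p' / p' / ?\<kappa>"
      using ratio connective_constant_nonneg by (intro divide_right_mono) auto
    then show "\<mu> p / (p * ?\<kappa>) \<le> \<mu> p' / (p' * ?\<kappa>)" by simp
  qed
  ultimately show ?thesis by blast
qed

end
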